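(* Let $\mathbb{L}=(\mathcal{P},\mathcal{C},\parallel)$ be a Laguerre plane satisfying axioms (C) and (S). An automorphism $\sigma$ of $\mathbb{L}$ is a Laguerre symmetry if and only if $\sigma=\mathrm{S}_{\{K,L\}}$ for some circles $K,L$ with $|K\cap L|=2$.
   Context: A Laguerre plane is a triple $(\mathcal{P},\mathcal{C},\parallel)$ where $\mathcal{P}$ is a set of points, $\mathcal{C}\subset 2^{\mathcal{P}}$ a set of circles and $\parallel$ an equivalence relation on $\mathcal{P}$ (parallelism; its classes are called generators) such that: (1) any three pairwise non-parallel points lie on a unique circle; (2) for every circle $K$ and non-parallel points $p\in K$, $q\notin K$ there is exactly one circle $L$ with $q\in L$ and $K\cap L=\{p\}$; (3) for every point $p$ and circle $K$ there is exactly one point $q\in K$ with $q\parallel p$; (4) some circle contains at least three but not all points. Circles $K,L$ are tangent at $p$ if $K\cap L=\{p\}$ or $K=L$ (with $p\in K$); they are tangent if tangent at some point. For $p\in K$, $\langle p,K\rangle$ denotes the set of circles tangent to $K$ at $p$. Axiom (C): for any circles $K,L$ and any point $p\in K\setminus L$ there exists exactly one circle $M\in\langle p,K\rangle$ with $|M\cap L|=1$. Axiom (S): if $K,L,M,N$ are circles and $a,b,c,d$ points with $K\cap L=\{a\}$, $L\cap M=\{b\}$, $M\cap N=\{c\}$, $N\cap K=\{d\}$ and $a\nparallel c$, then there is a circle containing $a,b,c,d$. Notation: for distinct circles $K,L$ and $x\in K\setminus L$, let $M$ be the unique circle of $\langle x,K\rangle$ with $|M\cap L|=1$; then $xKL$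 is the unique point of $M\cap L$; for $x\in K\cap L$, $xKL:=x$. An automorphism is a bijection of $\mathcal{P}$ mapping the set of circles onto itself; involutory means its square is the identity. For non-tangent circles $K,L$, the double tangency symmetry $\mathrm{S}_{\{K,L\}}$ is the unique involutory automorphism $\phi$ such that $\phi(x)=xKL$ for all $x\in K$ and $\phi(M)=M$ whenever $x$ is a point with $\phi(x)\neq x$ and $M$ is a circle containing $x$ and $\phi(x)$ (such $\phi$ exists and is unique in planes satisfying (C) and (S)). A Laguerre symmetry is an involutory automorphism for which there exist two distinct generators $X,Y$ and a circle $M$ such that it fixes every point of $X\cup Y$ and maps $M$ onto itself, but does not fix $M$ pointwise. *)

theory Defs
  imports Main
begin

text \<open>Points are the elements of the type 'p (the point set P is UNIV),
  circles form a set C of point sets, par is the parallelism relation.\<close>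

definition laguerre_plane :: "'p set set \<Rightarrow> ('p \<Rightarrow> 'p \<Rightarrow> bool) \<Rightarrow> bool" where
  "laguerre_plane C par \<longleftrightarrow>
     equivp par \<and>
     (\<forall>p q r. \<not> par p q \<and> \<not> par q r \<and> \<not> par p r \<longrightarrow>
        (\<exists>!K. K \<in> C \<and> p \<in> K \<and> q \<in> K \<and> r \<in> K)) \<and>
     (\<forall>K p q. K \<in> C \<and> p \<in> K \<and> q \<notin> K \<and> \<not> par p q \<longrightarrow>
        (\<exists>!L. L \<in> C \<and> q \<in> L \<and> K \<inter> L = {p})) \<and>
     (\<forall>p K. K \<in> C \<longrightarrow> (\<exists>!q. q \<in> K \<and> par q p)) \<and>
     (\<exists>K\<in>C. (\<exists>a b c. a \<in> K \<and> b \<in> K \<and> c \<in> K \<and> a \<noteq> b \<and> b \<noteq> c \<and> a \<noteq> c) \<and> K \<noteq> UNIV)"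

definition tangent_at :: "'p \<Rightarrow> 'p set \<Rightarrow> 'p set \<Rightarrow> bool" where
  "tangent_at p K L \<longleftrightarrow> p \<in> K \<and> p \<in> L \<and> (K \<inter> L = {p} \<or> K = L)"

definition tangent :: "'p set \<Rightarrow> 'p set \<Rightarrow> bool" where
  "tangent K L \<longleftrightarrow> (\<exists>p. tangent_at p K L)"

definition pencil :: "'p set set \<Rightarrow> 'p \<Rightarrow> 'p set \<Rightarrow> 'p set set" where
  "pencil C p K = {M. M \<in> C \<and> tangent_at p K M}"

definition axiom_C :: "'p set set \<Rightarrow> bool" where
  "axiom_C C \<longleftrightarrow> (\<forall>K L p. K \<in> C \<and> L \<in> C \<and> p \<in> K \<and> p \<notin> L \<longrightarrow>
      (\<exists>!M. M \<in> pencil C p K \<and> card (M \<inter> L) = 1))"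

definition axiom_S :: "'p set set \<Rightarrow> ('p \<Rightarrow> 'p \<Rightarrow> bool) \<Rightarrow> bool" where
  "axiom_S C par \<longleftrightarrow> (\<forall>K L M N a b c d.
      K \<in> C \<and> L \<in> C \<and> M \<in> C \<and> N \<in> C \<and>
      K \<inter> L = {a} \<and> L \<inter> M = {b} \<and> M \<inter> N = {c} \<and> N \<inter> K = {d} \<and> \<not> par a c \<longrightarrow>
      (\<exists>Z\<in>C. a \<in> Z \<and> b \<in> Z \<and> c \<in> Z \<and> d \<in> Z))"

definition xKL :: "'p set set \<Rightarrow> 'p \<Rightarrow> 'p set \<Rightarrow> 'p set \<Rightarrow> 'p" where
  "xKL C x K L = (if x \<in> L then x
     else (THE y. y \<in> (THE M. M \<in> pencil C x K \<and> card (M \<inter> L) = 1) \<inter> L))"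

definition automorphism :: "'p set set \<Rightarrow> ('p \<Rightarrow> 'p) \<Rightarrow> bool" where
  "automorphism C f \<longleftrightarrow> bij f \<and> (\<lambda>K. f ` K) ` C = C"

definition involutory :: "('p \<Rightarrow> 'p) \<Rightarrow> bool" where
  "involutory f \<longleftrightarrow> f \<circ> f = id"

definition is_double_tangency_symmetry ::
    "'p set set \<Rightarrow> 'p set \<Rightarrow> 'p set \<Rightarrow> ('p \<Rightarrow> 'p) \<Rightarrow> bool" where
  "is_double_tangency_symmetry C K L \<phi> \<longleftrightarrow>
     automorphism C \<phi> \<and> involutory \<phi> \<and>
     (\<forall>x\<in>K. \<phi> x = xKL C x K L) \<and>
     (\<forall>x M. \<phi> x \<noteq> x \<and> M \<in> C \<and> x \<in> M \<and> \<phi> x \<in> M \<longrightarrow> \<phi> ` M = M)"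

definition double_tangency_symmetry :: "'p set set \<Rightarrow> 'p set \<Rightarrow> 'p set \<Rightarrow> ('p \<Rightarrow> 'p)" where
  "double_tangency_symmetry C K L = (THE \<phi>. is_double_tangency_symmetry C K L \<phi>)"

definition generator :: "('p \<Rightarrow> 'p \<Rightarrow> bool) \<Rightarrow> 'p set \<Rightarrow> bool" where
  "generator par X \<longleftrightarrow> (\<exists>x. X = {y. par x y})"

definition laguerre_symmetry :: "'p set set \<Rightarrow> ('p \<Rightarrow> 'p \<Rightarrow> bool) \<Rightarrow> ('p \<Rightarrow> 'p) \<Rightarrow> bool" where
  "laguerre_symmetry C par \<sigma> \<longleftrightarrow>
     automorphism C \<sigma> \<and> involutory \<sigma> \<and>
     (\<exists>X Y M. generator par X \<and> generator par Y \<and> X \<noteq> Y \<and> M \<in> C \<and>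
        (\<forall>x \<in> X \<union> Y. \<sigma> x = x) \<and> \<sigma> ` M = M \<and> \<not> (\<forall>x\<in>M. \<sigma> x = x))"

end

theory Submission
  imports Defs "HOL-Algebra.Free_Abelian_Groups"
begin

text \<open>
  A circle through a point \<open>p\<close> is a line of the derived affine plane at \<open>p\<close>. Axiom (C) excludes triangles of circles
  which are tangent in three distinct points, and together with (S) it yields, for every generator \<open>P\<close>, a group of
  automorphisms which fix \<open>P\<close> pointwise, leave every generator invariant, and are transitive on the points of every
  other generator. All these groups commute, and they generate an abelian group which is regular on the circles.

  Relative to a base circle, the plane is therefore a group with two families of subgroups \<open>S x\<close> (stabilizer of the
  point \<open>x\<close>) and \<open>T x\<close> (translations fixing the generator of \<open>x\<close>). In the model of polynomials of degree at most two,
  \<open>S x\<close> and \<open>T x\<close> consist of the polynomials with a simple, respectively double, zero at \<open>x\<close>. For \<open>p \<noteq> q\<close> the group is the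
  sum of \<open>T p\<close>, \<open>T q\<close> and \<open>S p \<inter> S q\<close>, and tangency forces the remaining points to act on \<open>S p \<inter> S q\<close> by commuting
  scalars, which are closed under negation. So the map which is the identity on \<open>T p + T q\<close> and inverts \<open>S p \<inter> S q\<close>
  permutes the cosets of the \<open>S x\<close>; composed with a suitable translation, it is the reflection exchanging
  two given circles through \<open>p\<close> and \<open>q\<close>.

  Conversely, a Laguerre symmetry leaves every circle through a point and its distinct image invariant, which identifies
  it as the double tangency symmetry of any circle that it moves and the image of that circle.
\<close>

section \<open>Circle groups\<close>

text \<open>Group elements stand for circles: \<open>a - b \<in> S x\<close> says that the circles
  of \<open>a\<close> and \<open>b\<close> meet on the generator of \<open>x\<close>,
  \<open>a - b \<in> T x\<close> that they are tangent there. The subgroup \<open>N\<close> replaces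
  zero, because the group will only map onto the elation group, with kernel \<open>N\<close>.
  \<open>TT_split\<close> and \<open>TT_unique\<close> are existence and uniqueness in axiom
  (C).\<close>

locale tangency_group =
  fixes I :: "'i set" and S T :: "'i \<Rightarrow> 'e::ab_group_add set" and N :: "'e set"
  assumes S_zero: "x \<in> I \<Longrightarrow> 0 \<in> S x"
    and S_diff: "x \<in> I \<Longrightarrow> a \<in> S x \<Longrightarrow> b \<in> S x \<Longrightarrow> a - b \<in> S x"
    and T_diff: "x \<in> I \<Longrightarrow> a \<in> T x \<Longrightarrow> b \<in> T x \<Longrightarrow> a - b \<in> T x"
    and N_diff: "a \<in> N \<Longrightarrow> b \<in> N \<Longrightarrow> a - b \<in> N"
    and N_zero: "0 \<in> N"
    and N_T: "x \<in> I \<Longrightarrow> a \<in> N \<Longrightarrow> a \<in> T x"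
    and T_S: "x \<in> I \<Longrightarrow> a \<in> T x \<Longrightarrow> a \<in> S x"
    and TS_N: "x \<in> I \<Longrightarrow> y \<in> I \<Longrightarrow> x \<noteq> y \<Longrightarrow> a \<in> T x \<Longrightarrow> a \<in> S y \<Longrightarrow> a \<in> N"
    and TS_split: "x \<in> I \<Longrightarrow> y \<in> I \<Longrightarrow> x \<noteq> y \<Longrightarrow> \<exists>t\<in>T x. e - t \<in> S y"
    and SSS_N: "x \<in> I \<Longrightarrow> y \<in> I \<Longrightarrow> z \<in> I \<Longrightarrow> x \<noteq> y \<Longrightarrow> x \<noteq> z \<Longrightarrow> y \<noteq> z \<Longrightarrow>
        a \<in> S x \<Longrightarrow> a \<in> S y \<Longrightarrow> a \<in> S z \<Longrightarrow> a \<in> N"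
    and SSS_split: "x \<in> I \<Longrightarrow> y \<in> I \<Longrightarrow> z \<in> I \<Longrightarrow> x \<noteq> y \<Longrightarrow> x \<noteq> z \<Longrightarrow> y \<noteq> z \<Longrightarrow>
        \<exists>w. w \<in> S x \<and> w \<in> S y \<and> e - w \<in> S z"
    and S_not_T: "x \<in> I \<Longrightarrow> e \<in> S x \<Longrightarrow> e \<notin> T x \<Longrightarrow> \<exists>y\<in>I. y \<noteq> x \<and> e \<in> S y"
    and TT_split: "x \<in> I \<Longrightarrow> e \<notin> S x \<Longrightarrow> \<exists>t\<in>T x. \<exists>y\<in>I. e - t \<in> T y"
    and TT_unique: "x \<in> I \<Longrightarrow> y \<in> I \<Longrightarrow> z \<in> I \<Longrightarrow> e \<notin> S x \<Longrightarrow> t \<in> T x \<Longrightarrow> e - t \<in> T y \<Longrightarrow>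
        t' \<in> T x \<Longrightarrow> e - t' \<in> T z \<Longrightarrow> t - t' \<in> N"
    and match: "x \<in> I \<Longrightarrow> y \<in> I \<Longrightarrow> r \<in> I \<Longrightarrow> r' \<in> I \<Longrightarrow> x \<noteq> y \<Longrightarrow> r \<noteq> x \<Longrightarrow> r \<noteq> y \<Longrightarrow> r' \<noteq> x \<Longrightarrow> r' \<noteq> y \<Longrightarrow>
        d \<in> S x \<Longrightarrow> d \<in> S r \<Longrightarrow> d' \<in> S x \<Longrightarrow> d' \<in> S r' \<Longrightarrow> d - d' \<in> T x \<Longrightarrow>
        e \<in> S y \<Longrightarrow> e \<in> S r \<Longrightarrow> e' \<in> S y \<Longrightarrow> e' \<in> S r' \<Longrightarrow> e - e' \<in> T y \<Longrightarrow>
        d - e \<in> T r \<Longrightarrow> d \<notin> N \<Longrightarrow> d' - e' \<in> T r'"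
    and third: "\<exists>r\<in>I. r \<noteq> x \<and> r \<noteq> y"
begin

lemma N_S: "x \<in> I \<Longrightarrow> a \<in> N \<Longrightarrow> a \<in> S x"
  using N_T T_S by blast

lemma T_zero: "x \<in> I \<Longrightarrow> 0 \<in> T x"
  using N_T N_zero by blast

lemma S_uminus: "x \<in> I \<Longrightarrow> a \<in> S x \<Longrightarrow> - a \<in> S x"
  using S_diff[OF _ S_zero] by fastforce

lemma T_uminus: "x \<in> I \<Longrightarrow> a \<in> T x \<Longrightarrow> - a \<in> T x"
  using T_diff[OF _ T_zero] by fastforce

lemma N_uminus: "a \<in> N \<Longrightarrow> - a \<in> N"
  using N_diff[OF N_zero] by fastforce

lemma S_add: "x \<in> I \<Longrightarrow> a \<in> S x \<Longrightarrow> b \<in> S x \<Longrightarrow> a + b \<in> S x"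
  using S_diff[OF _ _ S_uminus] by fastforce

lemma T_add: "x \<in> I \<Longrightarrow> a \<in> T x \<Longrightarrow> b \<in> T x \<Longrightarrow> a + b \<in> T x"
  using T_diff[OF _ _ T_uminus] by fastforce

lemma N_add: "a \<in> N \<Longrightarrow> b \<in> N \<Longrightarrow> a + b \<in> N"
  using N_diff[OF _ N_uminus] by fastforce

section \<open>Tangent triangles and division by two\<close>

text \<open>In the polynomial model, a quadratic has opposite derivatives at its two zeros; equal
  derivatives of \<open>k\<close>, \<open>m\<close> at \<open>x\<close> and of \<open>k\<close>,
  \<open>l\<close> at \<open>y\<close> hence make those of \<open>l\<close> and \<open>m\<close>
  opposite at \<open>r\<close>. The proof studies a second zero \<open>y2\<close> of
  \<open>l - t\<close>: if it is \<open>x\<close>, then \<open>l + m\<close> is \<open>t\<close>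
  modulo \<open>N\<close>; any other value contradicts (C).\<close>

lemma tangent_triangle:
  assumes I: "x \<in> I" "y \<in> I" "r \<in> I" and ne: "x \<noteq> y" "x \<noteq> r" "y \<noteq> r"
    and k: "k \<in> S x" "k \<in> S y" and m: "m \<in> S x" "m \<in> S r" and l: "l \<in> S y" "l \<in> S r"
    and km: "k - m \<in> T x" and kl: "k - l \<in> T y"
  shows "l + m \<in> T r"
proof (cases "k \<in> N")
  case True
  have "m \<in> T x" using T_diff[OF I(1) N_T[OF I(1) True] km] by simp
  then have "m \<in> N" using TS_N I ne m by blast
  moreover have "l \<in> T y" using T_diff[OF I(2) N_T[OF I(2) True] kl] by simp
  then have "l \<in> N" using TS_N I ne l by blast
  ultimately show ?thesis using N_add N_T I by blast
next
  case False
  have mN: "m \<notin> N"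
  proof
    assume "m \<in> N"
    then have "(k - m) + m \<in> T x" using T_add[OF I(1) km N_T[OF I(1)]] by blast
    then have "k \<in> T x" by simp
    then show False using TS_N I ne k False by blast
  qed
  have mSy: "m \<notin> S y" using SSS_N[of x y r m] I ne m mN by blast
  obtain t where t: "t \<in> T r" "m - t \<in> S y" using TS_split[of r y m] I ne by auto
  have tS: "t \<in> S r" using t T_S I by blast
  have "l - t \<in> S r" using S_diff I l tS by blast
  moreover have "l - t \<notin> T r"
  proof
    assume "l - t \<in> T r"
    then have "l \<in> T r" using T_add[OF I(3) _ t(1)] by fastforce
    then have "l \<in> N" using TS_N I ne l by blast
    then have "(k - l) + l \<in> T y" using T_add[OF I(2) kl N_T[OF I(2)]] by blast
    then have "k \<in> T y" by simp
    then show False using TS_N I ne k False by blast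
  qed
  ultimately obtain y2 where y2: "y2 \<in> I" "y2 \<noteq> r" "l - t \<in> S y2" using S_not_T I by blast
  have "y2 \<noteq> y"
  proof
    assume "y2 = y"
    then have "t \<in> S y" using S_diff[OF I(2) l(1), of "l - t"] y2 by simp
    then have "m \<in> S y" using S_add[OF I(2) t(2)] by fastforce
    then show False using mSy by blast
  qed
  show ?thesis
  proof (cases "y2 = x")
    case True
    have "(l - t) + m \<in> S x" using S_add[OF I(1) _ m(1)] y2 True by blast
    moreover have "(l - t) + m \<in> S y" using S_add[OF I(2) l(1) t(2)] by (simp add: algebra_simps)
    moreover have "(l - t) + m \<in> S r" using S_add[OF I(3) S_diff[OF I(3) l(2) tS] m(2)] .
    ultimately have "(l - t) + m \<in> N" using SSS_N[of x y r] I ne by blast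
    then have "(l - t + m) + t \<in> T r" using T_add[OF I(3) N_T[OF I(3)] t(1)] by blast
    then show ?thesis by (simp add: algebra_simps)
  next
    case False
    obtain c where c: "c \<in> T x" "k - c \<in> S y2" using TS_split[of x y2 k] I y2 False by auto
    obtain c1 where c1: "c1 \<in> T y" "(m - t) - c1 \<in> S y2"
      using TS_split[of y y2 "m - t"] I y2 \<open>y2 \<noteq> y\<close> by auto
    have kc: "k - c \<in> S x" using S_diff k(1) c(1) T_S I by blast
    have a: "m - t \<in> S r" using S_diff I m tS by blast
    have V: "(m - t) - c1 \<in> S y" using S_diff t(2) c1(1) T_S I by blast
    \<comment> \<open>\<open>match\<close> is used twice with target \<open>y2\<close>, for the
      pencils at \<open>x\<close>, \<open>y\<close> and for those at \<open>x\<close>,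
      \<open>r\<close>. Subtraction then writes \<open>m - l\<close> as \<open>c1\<close> plus an
      element of \<open>T y2\<close>.\<close>
    have "m - (k - c) \<in> T x" using T_diff[OF I(1) c(1) km] by (simp add: algebra_simps)
    then have 1: "(k - c) - ((m - t) - c1) \<in> T y2"
      using match[of x y r y2 m "k - c" "m - t" "(m - t) - c1"] I ne y2 \<open>y2 \<noteq> y\<close> False
        m kc c(2) t(2) V a c1 mN t(1) by auto
    have 2: "(k - c) - (l - t) \<in> T y2"
      using match[of x r y y2 k "k - c" l "l - t"] I ne y2 \<open>y2 \<noteq> y\<close> False k kc c l
        S_diff[OF I(3) l(2) tS] t(1) kl \<open>k \<notin> N\<close> by auto
    have 3: "(m - l) - c1 \<in> T y2"
      using T_diff[OF y2(1) 2 1] by (simp add: algebra_simps)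
    have mlS: "m - l \<notin> S y"
    proof
      assume "m - l \<in> S y"
      then have "m \<in> S y" using S_add[OF I(2) _ l(1)] by fastforce
      then show False using mSy by blast
    qed
    \<comment> \<open>\<open>m - l\<close> also splits into \<open>k - l\<close> from
      \<open>T y\<close> and \<open>m - k\<close> from \<open>T x\<close>; uniqueness in (C) makes
      the two splittings agree modulo \<open>N\<close>.\<close>
    have 4: "(m - l) - (k - l) \<in> T x" using T_uminus[OF I(1) km] by simp
    have 5: "c1 - (k - l) \<in> N" using TT_unique[OF I(2) y2(1) I(1) mlS c1(1) 3 kl 4] .
    have "((m - l) - c1) + (c1 - (k - l)) \<in> T y2" using T_add[OF y2(1) 3 N_T[OF y2(1) 5]] .
    then have "m - k \<in> T y2" by (simp add: algebra_simps)
    moreover have "m - k \<in> T x" using 4 by simp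
    ultimately have "m - k \<in> N" using TS_N[of x y2] I y2 False T_S by blast
    then have "m - (m - k) \<in> S r" using S_diff[OF I(3) m(2) N_S[OF I(3)]] by blast
    then have "k \<in> S r" by simp
    then show ?thesis using SSS_N[of x y r k] I ne k \<open>k \<notin> N\<close> by blast
  qed
qed

text \<open>In the model: the characteristic is not two. For a counterexample \<open>e\<close> with
  second zero \<open>x\<close>, \<open>tangent_triangle\<close> and the hypothesis on
  \<open>e + e\<close> give \<open>c2 - c1 \<in> T r\<close>. Then \<open>c2\<close> splits over
  \<open>T x\<close> both by \<open>c1\<close> and by \<open>0\<close>, so (C) puts
  \<open>c1\<close> into \<open>N\<close>, which would force \<open>e \<in> S r\<close>.\<close>

lemma double_in_T:
  assumes p: "p \<in> I" and e: "e \<in> S p" and ee: "e + e \<in> T p"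
  shows "e \<in> T p"
proof (rule ccontr)
  assume eT: "e \<notin> T p"
  then obtain x where x: "x \<in> I" "x \<noteq> p" "e \<in> S x" using S_not_T p e by blast
  obtain r where r: "r \<in> I" "r \<noteq> x" "r \<noteq> p" using third by blast
  have eN: "e \<notin> S r" using SSS_N[of x p r e] x p r e eT N_T by blast
  obtain c1 where c1: "c1 \<in> T x" "e - c1 \<in> S r" using TS_split[of x r e] x r by auto
  obtain c2 where c2: "c2 \<in> T p" "e - c2 \<in> S r" using TS_split[of p r e] p r by auto
  have lp: "e - c2 \<in> S p" using S_diff p e c2(1) T_S by blast
  have mx: "e - c1 \<in> S x" using S_diff x c1(1) T_S by blast
  have D: "(e - c2) + (e - c1) \<in> T r"
    using tangent_triangle[of x p r e "e - c1" "e - c2"] x p r e c1 c2 lp mx by auto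
  have "(e + e) - (c2 + c2) \<in> T p" using T_diff[OF p ee T_add[OF p c2(1) c2(1)]] .
  then have "(e - c2) + (e - c2) \<in> T p" by (simp add: algebra_simps)
  moreover have "(e - c2) + (e - c2) \<in> S r" using S_add[OF r(1) c2(2) c2(2)] .
  ultimately have "(e - c2) + (e - c2) \<in> N" using TS_N[of p r] p r by blast
  then have "(e - c2) + (e - c1) - ((e - c2) + (e - c2)) \<in> T r" using T_diff[OF r(1) D N_T[OF r(1)]] by blast
  then have 1: "c2 - c1 \<in> T r" by (simp add: algebra_simps)
  have "c2 \<notin> S x"
  proof
    assume "c2 \<in> S x"
    then have "c2 \<in> N" using TS_N[of p x c2] p x c2 by blast
    then have "(e - c2) + c2 \<in> S r" using S_add[OF r(1) c2(2) N_S[OF r(1)]] by blast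
    then show False using eN by simp
  qed
  then have "c1 - 0 \<in> N"
    using TT_unique[of x r p c2 c1 0] x r p 1 c1 c2 T_zero by auto
  then have "c1 \<in> N" by simp
  then have "(e - c1) + c1 \<in> S r" using S_add[OF r(1) c1(2) N_S[OF r(1)]] by blast
  then show False using eN by simp
qed

lemma double_in_N:
  assumes "p \<in> I" "x \<in> I" "p \<noteq> x" "e \<in> S p" "e \<in> S x" "e + e \<in> N"
  shows "e \<in> N"
  using double_in_T[of p e] TS_N[of p x e] N_T assms by blast

text \<open>Splitting \<open>a\<close> into an element of \<open>S p \<inter> S q\<close> and one of
  \<open>S x\<close> reduces the claim to \<open>double_in_N\<close>.\<close>

lemma double_T_in_N:
  assumes p: "p \<in> I" and a: "a \<in> T p" and aa: "a + a \<in> N"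
  shows "a \<in> N"
proof -
  obtain q where q: "q \<in> I" "q \<noteq> p" using third by blast
  obtain x where x: "x \<in> I" "x \<noteq> p" "x \<noteq> q" using third by blast
  obtain w where w: "w \<in> S p" "w \<in> S q" "a - w \<in> S x" using SSS_split[of p q x a] p q x by auto
  have "(a + a) - ((a - w) + (a - w)) \<in> S x"
    using S_diff[OF x(1) N_S[OF x(1) aa] S_add[OF x(1) w(3) w(3)]] .
  then have "w + w \<in> S x" by (simp add: algebra_simps)
  then have "w + w \<in> N" using SSS_N[of p q x "w + w"] S_add w p q x by blast
  then have "w \<in> N" using double_in_N[of p q w] p q w by blast
  then have "(a - w) + w \<in> S x" using S_add[OF x(1) w(3) N_S[OF x(1)]] by blast
  then show ?thesis using TS_N[of p x a] p x a by simp
qed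

text \<open>Halves come from (C): split \<open>w\<close> into elements of \<open>T x\<close> and
  \<open>T y\<close>; the \<open>n\<close> in \<open>S p \<inter> S x\<close> that agrees with
  \<open>w\<close> at \<open>y\<close> satisfies \<open>w - (n + n) \<in> T p\<close> by
  \<open>tangent_triangle\<close>, and a correction from \<open>T p\<close> moves it into
  \<open>S q\<close>. The half later yields a circle invariant under the reflection.\<close>

lemma exists_half:
  assumes p: "p \<in> I" and q: "q \<in> I" and pq: "p \<noteq> q" and w: "w \<in> S p" "w \<in> S q"
  shows "\<exists>n. n \<in> S p \<and> n \<in> S q \<and> w - (n + n) \<in> N"
proof (cases "w \<in> N")
  case True
  then show ?thesis using S_zero p q by force
next
  case False
  obtain x where x: "x \<in> I" "x \<noteq> p" "x \<noteq> q" using third by blast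
  have "w \<notin> S x" using SSS_N[of p q x w] p q x pq w False by blast
  then obtain t y where t: "t \<in> T x" "y \<in> I" "w - t \<in> T y" using TT_split x by blast
  have yx: "y \<noteq> x"
  proof
    assume "y = x"
    then have "w \<in> T x" using T_add[OF x(1) _ t(1)] t(3) by fastforce
    then show False using \<open>w \<notin> S x\<close> T_S x by blast
  qed
  have *: "y \<noteq> z" if z: "z \<in> I" "w \<in> S z" "z' \<in> I" "z \<noteq> z'" "w \<in> S z'" "x \<noteq> z" for z z'
  proof
    assume yz: "y = z"
    then have "w - (w - t) \<in> S z" using S_diff[OF z(1,2)] t(3) T_S z by blast
    then have "t \<in> N" using TS_N[of x z t] x z t by auto
    then have "(w - t) + t \<in> T z" using T_add[OF z(1)] t(3) yz N_T[OF z(1)] by blast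
    then show False using TS_N[of z z' w] z False by simp
  qed
  have yp: "y \<noteq> p" and yq: "y \<noteq> q" using *[of p q] *[of q p] p q pq w x by auto
  obtain n where n: "n \<in> S p" "n \<in> S x" "w - n \<in> S y" using SSS_split[of p x y w] p x t yp yx by auto
  have "t - n \<in> S x" using S_diff t(1) T_S x n by blast
  moreover have "t - n \<in> S y" using S_diff[OF t(2) n(3) T_S[OF t(2) t(3)]] by (simp add: algebra_simps)
  moreover have "(t - n) - (w - n) \<in> T y" using T_uminus[OF t(2,3)] by simp
  ultimately have "(w - n) + (- n) \<in> T p"
    using tangent_triangle[of x y p "t - n" "- n" "w - n"] x t p yp yx n S_uminus S_diff w by auto
  moreover obtain t1 where t1: "t1 \<in> T p" "n - t1 \<in> S q" using TS_split[of p q n] p q pq by auto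
  ultimately have "(w - n) + (- n) + (t1 + t1) \<in> T p" using T_add[OF p _ T_add[OF p t1(1) t1(1)]] by blast
  then have "w - ((n - t1) + (n - t1)) \<in> T p" by (simp add: algebra_simps)
  moreover have "w - ((n - t1) + (n - t1)) \<in> S q" using S_diff[OF q w(2) S_add[OF q t1(2) t1(2)]] .
  ultimately have "w - ((n - t1) + (n - t1)) \<in> N" using TS_N[of p q] p q pq by blast
  then show ?thesis using S_diff[OF p n(1) T_S[OF p t1(1)]] t1(2) by blast
qed

section \<open>Coordinates with respect to two indices\<close>

text \<open>With \<open>p\<close> at infinity and \<open>q\<close> at 0, \<open>a\<close>,
  \<open>w\<close> and \<open>b\<close> are the constant, linear and quadratic terms of a multiple
  of \<open>(X - x)^2\<close>. Half of the linear term is the \<open>v\<close> for which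
  \<open>v + a\<close> vanishes at \<open>x\<close>.\<close>

lemma T_middle_part:
  assumes p: "p \<in> I" and q: "q \<in> I" and x: "x \<in> I" and ne: "p \<noteq> q" "x \<noteq> p" "x \<noteq> q"
    and a: "a \<in> T p" and b: "b \<in> T q" and w: "w \<in> S p" "w \<in> S q" and t: "a + b + w \<in> T x"
    and v: "v \<in> S p" "v \<in> S q" "v + a \<in> S x"
  shows "w - (v + v) \<in> N"
proof -
  let ?t = "a + b + w" and ?n = "v + a"
  have n: "?n \<in> S p" using S_add[OF p v(1) T_S[OF p a]] .
  have "?t - ?n \<in> S x" using S_diff[OF x T_S[OF x t] v(3)] .
  moreover have "?t - ?n \<in> S q"
    using S_diff[OF q S_add[OF q T_S[OF q b] w(2)] v(2)] by (simp add: algebra_simps)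
  moreover have "(?t - ?n) - (w - v) \<in> T q" using b by (simp add: algebra_simps)
  moreover have "(?t - ?n) - (- ?n) \<in> T x" using t by (simp add: algebra_simps)
  ultimately have "(w - v) + (- ?n) \<in> T p"
    using tangent_triangle[of x q p "?t - ?n" "- ?n" "w - v"] x q p ne
      S_uminus n v S_diff w by metis
  then have "(w - v) + (- ?n) + a \<in> T p" using T_add[OF p _ a] by blast
  then have "w - (v + v) \<in> T p" by (simp add: algebra_simps)
  moreover have "w - (v + v) \<in> S q" using S_diff[OF q w(2) S_add[OF q v(2) v(2)]] .
  ultimately show ?thesis using TS_N[of p q] p q ne by blast
qed

text \<open>A converse of \<open>T_middle_part\<close>: some \<open>t \<in> T x\<close> has the same
  quadratic part \<open>b\<close>; its other parts satisfy the same conditions as \<open>a\<close>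
  and \<open>v\<close>, and these conditions determine them modulo \<open>N\<close>.\<close>

lemma T_decomposition:
  assumes p: "p \<in> I" and q: "q \<in> I" and x: "x \<in> I" and ne: "p \<noteq> q" "x \<noteq> p" "x \<noteq> q"
    and a: "a \<in> T p" and b: "b \<in> T q" and v: "v \<in> S p" "v \<in> S q" "v + a \<in> S x" "v + b \<in> S x"
  shows "a + b + (v + v) \<in> T x"
proof -
  obtain t where t: "t \<in> T x" "b - t \<in> S p" using TS_split[of x p b] x p ne by auto
  have tbp: "t - b \<in> S p" using S_uminus[OF p t(2)] by simp
  obtain a' where a': "a' \<in> T p" "(t - b) - a' \<in> S q" using TS_split[of p q "t - b"] p q ne by auto
  let ?w = "(t - b) - a'"
  have wp: "?w \<in> S p" using S_diff[OF p tbp T_S[OF p a'(1)]] .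
  obtain v' where v': "v' \<in> S p" "v' \<in> S q" "- a' - v' \<in> S x"
    using SSS_split[of p q x "- a'"] p q x ne by auto
  have va': "v' + a' \<in> S x" using S_uminus[OF x v'(3)] by (simp add: algebra_simps)
  have tt: "a' + b + ?w \<in> T x" using t(1) by (simp add: algebra_simps)
  have wN: "?w - (v' + v') \<in> N" using T_middle_part[OF p q x ne a'(1) b wp a'(2) tt v'(1,2) va'] .
  have "(a' + b + ?w) - (?w - (v' + v')) - (v' + a') \<in> S x"
    using S_diff[OF x S_diff[OF x T_S[OF x tt] N_S[OF x wN]] va'] .
  then have "v' + b \<in> S x" by (simp add: algebra_simps)
  then have "(v + b) - (v' + b) \<in> S x" using S_diff x v(4) by blast
  then have vvN: "v - v' \<in> N" using SSS_N[of p q x "v - v'"] S_diff p q x ne v v' by auto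
  have "(v + a) - (v' + a') - (v - v') \<in> S x" using S_diff[OF x S_diff[OF x v(3) va'] N_S[OF x vvN]] .
  then have "a - a' \<in> S x" by (simp add: algebra_simps)
  then have aN: "a - a' \<in> N" using TS_N[of p x "a - a'"] p x ne T_diff[OF p a a'(1)] by blast
  have "(a - a') - (?w - (v' + v')) + ((v - v') + (v - v')) \<in> N"
    using N_add[OF N_diff[OF aN wN] N_add[OF vvN vvN]] .
  then have "(a' + b + ?w) + ((a - a') - (?w - (v' + v')) + ((v - v') + (v - v'))) \<in> T x"
    using T_add[OF x tt N_T[OF x]] by blast
  then show ?thesis by (simp add: algebra_simps)
qed

text \<open>In the coordinates given by \<open>p\<close> and \<open>q\<close>, every other index acts on \<open>S p \<inter> S q\<close> by a scalar;
  this closure statement of Pappus type says that the scalars commute.\<close>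

lemma pappus:
  assumes p: "p \<in> I" and q: "q \<in> I" and x: "x \<in> I" and y: "y \<in> I"
    and ne: "p \<noteq> q" "x \<noteq> p" "x \<noteq> q" "y \<noteq> p" "y \<noteq> q"
    and a: "a \<in> T p" and b: "b \<in> T q" and v: "v \<in> S p" "v \<in> S q" and z: "z \<in> S p" "z \<in> S q"
    and vb: "v + b \<in> S x" and zb: "z + b \<in> S y" and za: "z + a \<in> S x"
  shows "v + a \<in> S y"
proof (cases "x = y")
  case True
  have "(v + b) - (z + b) \<in> S x" using S_diff x vb zb True by blast
  then have "v - z \<in> S x" by simp
  then have "(v - z) + (z + a) \<in> S x" using S_add[OF x _ za] by blast
  then show ?thesis using True by simp
next
  case xy: False
  have ex: "\<exists>a\<in>T p. u + a \<in> S s" if s: "s \<in> I" "s \<noteq> p" for u s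
  proof -
    obtain c where c: "c \<in> T p" "u - c \<in> S s" using TS_split[of p s u] s p by auto
    show ?thesis using T_uminus[OF p c(1)] c(2) by (intro bexI[of _ "- c"]) auto
  qed
  obtain a1 where a1: "a1 \<in> T p" "v + a1 \<in> S x" using ex x ne by blast
  obtain a2 where a2: "a2 \<in> T p" "z + a2 \<in> S y" using ex y ne by blast
  have tx: "a1 + b + (v + v) \<in> T x" using T_decomposition[OF p q x ne(1-3) a1(1) b v a1(2) vb] .
  have ty: "a2 + b + (z + z) \<in> T y" using T_decomposition[OF p q y ne(1,4,5) a2(1) b z a2(2) zb] .
  \<comment> \<open>In the model, the elements in \<open>tx\<close> and \<open>ty\<close> are
    multiples of \<open>(X - x)^2\<close> and \<open>(X - y)^2\<close>. Expanding the second in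
    powers of \<open>X - x\<close> gives the linear term \<open>?u + ?u\<close> and the constant
    term \<open>?a\<close>.\<close>
  let ?u = "z - v + (a - a1)"
  have "(z + a) - (v + a1) \<in> S x" using S_diff x za a1 by blast
  then have ux: "?u \<in> S x" by (simp add: algebra_simps)
  have up: "?u \<in> S p" using S_add[OF p S_diff[OF p z(1) v(1)] S_diff[OF p T_S[OF p a] T_S[OF p a1(1)]]] .
  let ?a = "(a2 - a) - (a - a1)"
  have aT: "?a \<in> T p" using T_diff[OF p T_diff[OF p a2(1) a] T_diff[OF p a a1(1)]] .
  have "a2 + b + (z + z) = ?a + (a1 + b + (v + v)) + (?u + ?u)" by (simp add: algebra_simps)
  then have ty': "?a + (a1 + b + (v + v)) + (?u + ?u) \<in> T y" using ty by simp
  obtain v' where v': "v' \<in> S p" "v' \<in> S x" "- ?a - v' \<in> S y"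
    using SSS_split[of p x y "- ?a"] p x y ne xy by metis
  have v'a: "v' + ?a \<in> S y" using S_uminus[OF y v'(3)] by (simp add: algebra_simps)
  have uu: "?u + ?u \<in> S p" "?u + ?u \<in> S x" using S_add[OF p up up] S_add[OF x ux ux] .
  \<comment> \<open>\<open>T_middle_part\<close> with \<open>x\<close> in the place of
    \<open>q\<close>: both \<open>?u\<close> and \<open>v'\<close> halve the linear term, and halves
    are unique by \<open>double_in_N\<close>.\<close>
  have "(?u + ?u) - (v' + v') \<in> N"
    using T_middle_part[OF p x y ne(2)[symmetric] ne(4) xy[symmetric] aT tx uu ty' v'(1,2) v'a] .
  then have "(?u - v') + (?u - v') \<in> N" by (simp add: algebra_simps)
  then have "?u - v' \<in> N" using double_in_N[of p x "?u - v'"] S_diff p x ne up ux v' by blast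
  then have "(?u - v') + (v' + ?a) \<in> S y" using S_add[OF y N_S[OF y] v'a] by blast
  then have "(z + a2) - ((?u - v') + (v' + ?a)) \<in> S y" using S_diff[OF y a2(2)] by blast
  then show ?thesis by (simp add: algebra_simps)
qed

text \<open>The pair \<open>w\<close>, \<open>a\<close> tests that the scalar of \<open>x'\<close>
  is the negative of that of \<open>x\<close>. An index \<open>y\<close> with
  \<open>w + b \<in> S y\<close> carries this over to other pairs: \<open>pappus\<close> is applied
  to \<open>x\<close> and, with the signs of \<open>b\<close> and \<open>w\<close> reversed, to
  \<open>x'\<close>.\<close>

lemma negate_scalar:
  assumes p: "p \<in> I" and q: "q \<in> I" and x: "x \<in> I" and x': "x' \<in> I"
    and ne: "p \<noteq> q" "x \<noteq> p" "x \<noteq> q" "x' \<noteq> p" "x' \<noteq> q"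
    and a: "a \<in> T p" and w: "w \<in> S p" "w \<in> S q" "w \<notin> N" and wa: "w + a \<in> S x" "a - w \<in> S x'"
    and b: "b \<in> T q" and v: "v \<in> S p" "v \<in> S q" and vb: "v + b \<in> S x"
  shows "b - v \<in> S x'"
proof (cases "b \<in> N")
  case True
  have "v + b - b \<in> S x" using S_diff[OF x vb N_S[OF x True]] .
  then have "v \<in> N" using SSS_N[of p q x v] p q x ne v by simp
  then show ?thesis using N_S[OF x' N_diff[OF True]] by blast
next
  case bN: False
  have wbq: "w + b \<in> S q" using S_add[OF q w(2) T_S[OF q b]] .
  have "w + b \<notin> T q"
  proof
    assume "w + b \<in> T q"
    then have "w \<in> T q" using T_diff[OF q _ b] by fastforce
    then show False using TS_N[of q p w] p q ne w by blast
  qed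
  then obtain y where y: "y \<in> I" "y \<noteq> q" "w + b \<in> S y" using S_not_T[OF q wbq] by blast
  have yp: "y \<noteq> p"
  proof
    assume "y = p"
    then have "b \<in> S p" using S_diff[OF p _ w(1), of "w + b"] y by simp
    then show False using TS_N[of q p b] p q ne b bN by blast
  qed
  have 1: "v + a \<in> S y" using pappus[OF p q x y(1) ne(1-3) yp y(2) a b v w(1,2) vb y(3) wa(1)] .
  obtain v' where v': "v' \<in> S p" "v' \<in> S q" "b - v' \<in> S x'" using SSS_split[of p q x' b] p q x' ne by metis
  have "v' + a \<in> S y"
  proof (rule pappus[OF p q x' y(1) ne(1,4,5) yp y(2) a T_uminus[OF q b] v'(1,2) S_uminus[OF p w(1)] S_uminus[OF q w(2)]])
    show "v' + - b \<in> S x'" using S_uminus[OF x' v'(3)] by simp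
    show "- w + - b \<in> S y" using S_uminus[OF y(1,3)] by (simp add: algebra_simps)
    show "- w + a \<in> S x'" using wa(2) by simp
  qed
  then have "(v + a) - (v' + a) \<in> S y" using S_diff y 1 by blast
  then have "v - v' \<in> N" using SSS_N[of p q y "v - v'"] p q y yp ne S_diff v v' by auto
  then have "(b - v') - (v - v') \<in> S x'" using S_diff[OF x' v'(3) N_S[OF x']] by blast
  then show ?thesis by simp
qed

text \<open>With \<open>p\<close> at infinity and \<open>q\<close> at 0, \<open>x'\<close> is
  \<open>-x\<close>. It is found as the second zero of \<open>a0 - w\<close>; it differs from
  \<open>x\<close> because there is no 2-torsion modulo \<open>N\<close>.\<close>

lemma exists_reflected_index:
  assumes p: "p \<in> I" and q: "q \<in> I" and x: "x \<in> I" and ne: "p \<noteq> q" "x \<noteq> p" "x \<noteq> q"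
    and w: "w \<in> S p" "w \<in> S q" "w \<notin> N"
  shows "\<exists>x'\<in>I. x' \<noteq> p \<and> x' \<noteq> q \<and> x' \<noteq> x \<and>
    (\<forall>a\<in>T p. \<forall>b\<in>T q. \<forall>v\<in>S p \<inter> S q. a + b + v \<in> S x \<longrightarrow> a + b - v \<in> S x')"
proof -
  obtain c where c: "c \<in> T p" "w - c \<in> S x" using TS_split[of p x w] p x ne by auto
  define a0 where "a0 = - c"
  have a0: "a0 \<in> T p" "w + a0 \<in> S x" using c T_uminus[OF p] by (auto simp: a0_def)
  obtain c' where c': "c' \<in> T q" "w - c' \<in> S x" using TS_split[of q x w] q x ne by auto
  define b0 where "b0 = - c'"
  have b0: "b0 \<in> T q" "w + b0 \<in> S x" using c' T_uminus[OF q] by (auto simp: b0_def)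
  have "a0 - w \<in> S p" using S_diff[OF p T_S[OF p a0(1)] w(1)] .
  moreover have "a0 - w \<notin> T p"
  proof
    assume "a0 - w \<in> T p"
    then have "w \<in> T p" using T_diff[OF p a0(1), of "a0 - w"] by simp
    then show False using TS_N[of p q w] p q ne w by blast
  qed
  ultimately obtain x' where x': "x' \<in> I" "x' \<noteq> p" "a0 - w \<in> S x'" using S_not_T p by blast
  have a0N: "a0 \<notin> N"
  proof
    assume "a0 \<in> N"
    then have "w \<in> S x" using S_diff[OF x a0(2) N_S[OF x]] by fastforce
    then show False using SSS_N[of p q x w] p q x ne w by blast
  qed
  have x'q: "x' \<noteq> q"
  proof
    assume "x' = q"
    then have "a0 \<in> S q" using S_add[OF q _ w(2), of "a0 - w"] x' by simp
    then show False using TS_N[of p q a0] p q ne a0 a0N by blast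
  qed
  have x'x: "x' \<noteq> x"
  proof
    assume "x' = x"
    then have "(w + a0) + (a0 - w) \<in> S x" using S_add[OF x a0(2)] x' by blast
    then have "a0 + a0 \<in> S x" by simp
    then have "a0 + a0 \<in> N" using TS_N[of p x "a0 + a0"] p x ne T_add a0 by blast
    then show False using double_T_in_N p a0 a0N by blast
  qed
  have B: "b - v \<in> S x'" if "b \<in> T q" "v \<in> S p" "v \<in> S q" "v + b \<in> S x" for b v
    using negate_scalar[OF p q x x'(1) ne x'(2) x'q a0(1) w a0(2) x'(3)] that by blast
  \<comment> \<open>\<open>p\<close> and \<open>q\<close> are exchanged here, so a test pair with
    second entry in \<open>T q\<close> is required; \<open>B\<close> supplies it with
    \<open>w\<close> and \<open>b0\<close>.\<close>
  have A: "a - v \<in> S x'" if "a \<in> T p" "v \<in> S p" "v \<in> S q" "v + a \<in> S x" for a v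
    using negate_scalar[OF q p x x'(1) ne(1)[symmetric] ne(3,2) x'q x'(2) b0(1) w(2,1,3) b0(2)
        B[OF b0(1) w(1,2) b0(2)]] that by blast
  have "a + b - v \<in> S x'"
    if a: "a \<in> T p" and b: "b \<in> T q" and v: "v \<in> S p" "v \<in> S q" and abv: "a + b + v \<in> S x" for a b v
  proof -
    \<comment> \<open>\<open>u\<close> is the share of \<open>v\<close> that cancels
      \<open>b\<close> at \<open>x\<close>, so the remainder \<open>v - u\<close> cancels
      \<open>a\<close>.\<close>
    obtain u where u: "u \<in> S p" "u \<in> S q" "- b - u \<in> S x" using SSS_split[of p q x "- b"] p q x ne by metis
    have ub: "u + b \<in> S x" using S_uminus[OF x u(3)] by (simp add: algebra_simps)
    have "(a + b + v) - (u + b) \<in> S x" using S_diff x abv ub by blast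
    then have "(v - u) + a \<in> S x" by (simp add: algebra_simps)
    then have "a - (v - u) \<in> S x'" using A[OF a, of "v - u"] S_diff p q v u by blast
    then have "(a - (v - u)) + (b - u) \<in> S x'" using S_add[OF x'(1)] B[OF b u(1,2) ub] by blast
    then show ?thesis by (simp add: algebra_simps)
  qed
  then show ?thesis using x' x'q x'x by blast
qed

end

section \<open>Tangency and translations\<close>

locale laguerre_CS =
  fixes C :: "'p set set" and par :: "'p \<Rightarrow> 'p \<Rightarrow> bool"
  assumes laguerre: "laguerre_plane C par" and C: "axiom_C C" and S: "axiom_S C par"
begin

section \<open>Incidence and tangency\<close>

lemma equivp_par: "equivp par"
  and circle_ex1: "\<not> par x y \<and> \<not> par y z \<and> \<not> par x z \<longrightarrow> (\<exists>!K. K \<in> C \<and> x \<in> K \<and> y \<in> K \<and> z \<in> K)"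
  and tangent_ex1: "K \<in> C \<and> x \<in> K \<and> y \<notin> K \<and> \<not> par x y \<longrightarrow> (\<exists>!L. L \<in> C \<and> y \<in> L \<and> K \<inter> L = {x})"
  and parallel_ex1: "K \<in> C \<longrightarrow> (\<exists>!y. y \<in> K \<and> par y x)"
  and rich: "\<exists>K\<in>C. (\<exists>a b c. a \<in> K \<and> b \<in> K \<and> c \<in> K \<and> a \<noteq> b \<and> b \<noteq> c \<and> a \<noteq> c) \<and> K \<noteq> UNIV"
  using laguerre unfolding laguerre_plane_def by simp_all

lemma par_refl [simp]: "par x x"
  using equivp_par by (rule equivp_reflp)

lemma par_sym: "par x y \<Longrightarrow> par y x"
  using equivp_par by (rule equivp_symp)

lemma par_trans: "par x y \<Longrightarrow> par y z \<Longrightarrow> par x z"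
  using equivp_par by (rule equivp_transp)

lemma circle_ex: "\<not> par x y \<Longrightarrow> \<not> par y z \<Longrightarrow> \<not> par x z \<Longrightarrow> \<exists>K\<in>C. x \<in> K \<and> y \<in> K \<and> z \<in> K"
  using circle_ex1[of x y z] by blast

lemma par_on_circle: "K \<in> C \<Longrightarrow> x \<in> K \<Longrightarrow> y \<in> K \<Longrightarrow> par x y \<Longrightarrow> x = y"
  using parallel_ex1[of K y] par_refl by blast

lemma circle_eq:
  assumes "K \<in> C" "L \<in> C" "x \<in> K" "y \<in> K" "z \<in> K" "x \<in> L" "y \<in> L" "z \<in> L"
    "x \<noteq> y" "y \<noteq> z" "x \<noteq> z"
  shows "K = L"
proof -
  have "\<not> par x y" "\<not> par y z" "\<not> par x z" using par_on_circle assms by blast+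
  then have "\<exists>!K. K \<in> C \<and> x \<in> K \<and> y \<in> K \<and> z \<in> K"
    using circle_ex1[of x y z] by blast
  then show ?thesis using assms by blast
qed

lemma circle_meet:
  assumes "K \<in> C" "L \<in> C" "x \<in> K" "y \<in> K" "x \<in> L" "y \<in> L" "x \<noteq> y" "K \<noteq> L"
  shows "K \<inter> L = {x, y}"
  using circle_eq assms by blast

definition proj :: "'p set \<Rightarrow> 'p \<Rightarrow> 'p" where
  "proj K x = (THE y. y \<in> K \<and> par y x)"

lemma proj: assumes "K \<in> C" shows "proj K x \<in> K" "par (proj K x) x"
proof -
  have "\<exists>!y. y \<in> K \<and> par y x" using parallel_ex1[of K x] assms by blast
  from theI'[OF this] show "proj K x \<in> K" "par (proj K x) x" by (simp_all add: proj_def)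
qed

lemma proj_eq: "K \<in> C \<Longrightarrow> y \<in> K \<Longrightarrow> par y x \<Longrightarrow> proj K x = y"
  using proj par_on_circle par_trans par_sym by meson

lemma proj_self: "K \<in> C \<Longrightarrow> x \<in> K \<Longrightarrow> proj K x = x"
  using proj_eq by simp

lemma tangent_at_refl: "x \<in> K \<Longrightarrow> tangent_at x K K"
  by (simp add: tangent_at_def)

lemma tangent_at_sym: "tangent_at x K L \<Longrightarrow> tangent_at x L K"
  by (auto simp: tangent_at_def)

lemma tangent_atD: "tangent_at x K L \<Longrightarrow> x \<in> K" "tangent_at x K L \<Longrightarrow> x \<in> L"
  by (auto simp: tangent_at_def)

lemma tangent_at_cases: "tangent_at x K L \<Longrightarrow> K = L \<or> K \<inter> L = {x}"
  by (auto simp: tangent_at_def)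

lemma tangent_at_eq: "tangent_at x K L \<Longrightarrow> y \<in> K \<Longrightarrow> y \<in> L \<Longrightarrow> y \<noteq> x \<Longrightarrow> K = L"
  by (auto simp: tangent_at_def)

lemma tangent_atI: "K \<inter> L = {x} \<Longrightarrow> tangent_at x K L"
  by (auto simp: tangent_at_def)

lemma tangent_ex:
  assumes "K \<in> C" "x \<in> K" "\<not> par x y" shows "\<exists>L\<in>C. y \<in> L \<and> tangent_at x K L"
proof (cases "y \<in> K")
  case True
  then show ?thesis using assms tangent_at_refl[of x K] by (intro bexI[of _ K]) auto
next
  case False
  then have "\<exists>!L. L \<in> C \<and> y \<in> L \<and> K \<inter> L = {x}"
    using tangent_ex1[of K x y] assms by blast
  then obtain L where "L \<in> C" "y \<in> L" "K \<inter> L = {x}" by (elim ex1E) blast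
  then show ?thesis using tangent_atI[of K L x] by blast
qed

lemma tangent_unique:
  assumes "K \<in> C" "L \<in> C" "M \<in> C" "tangent_at x K L" "tangent_at x K M" "y \<in> L" "y \<in> M" "y \<noteq> x"
  shows "L = M"
proof (cases "y \<in> K")
  case True
  then have "K = L" "K = M" using tangent_at_eq[OF assms(4)] tangent_at_eq[OF assms(5)] assms(6-8) by blast+
  then show ?thesis by simp
next
  case False
  have x: "x \<in> K" "x \<in> L" using tangent_atD[OF assms(4)] by simp_all
  then have "\<not> par x y" using par_on_circle[OF assms(2) x(2) assms(6)] assms(8) by auto
  then have ex1: "\<exists>!L. L \<in> C \<and> y \<in> L \<and> K \<inter> L = {x}"
    using tangent_ex1[of K x y] assms(1) x False by simp
  moreover have "K \<inter> L = {x}" "K \<inter> M = {x}"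
    using tangent_at_cases[OF assms(4)] tangent_at_cases[OF assms(5)] False assms by auto
  ultimately show ?thesis
    using the1_equality[OF ex1, of L] the1_equality[OF ex1, of M] assms by simp
qed

lemma tangent_trans:
  assumes "K \<in> C" "L \<in> C" "M \<in> C" "tangent_at x K L" "tangent_at x K M"
  shows "tangent_at x L M"
  using tangent_unique[OF assms] assms unfolding tangent_at_def by blast

lemma axiom_C_ex:
  assumes "K \<in> C" "L \<in> C" "x \<in> K" "x \<notin> L"
  shows "\<exists>M\<in>C. \<exists>y. tangent_at x K M \<and> M \<inter> L = {y}"
proof -
  obtain M where "M \<in> pencil C x K" "card (M \<inter> L) = 1" using C assms unfolding axiom_C_def by blast
  then show ?thesis by (auto simp: pencil_def card_1_singleton_iff)
qed

lemma axiom_C_unique: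
  assumes "K \<in> C" "L \<in> C" "x \<in> K" "x \<notin> L"
    and "M \<in> C" "tangent_at x K M" "M \<inter> L = {y}" and "M' \<in> C" "tangent_at x K M'" "M' \<inter> L = {y'}"
  shows "M = M'"
proof -
  have "M \<in> pencil C x K" "card (M \<inter> L) = 1" "M' \<in> pencil C x K" "card (M' \<inter> L) = 1"
    using assms by (auto simp: pencil_def)
  then show ?thesis using C assms(1-4) unfolding axiom_C_def by blast
qed

text \<open>Otherwise the pencil of \<open>L\<close> at \<open>x\<close> contains both
  \<open>K\<close> and \<open>L\<close>, each meeting \<open>M\<close> in a single point, against
  (C).\<close>

lemma tangent_triple:
  assumes "K \<in> C" "L \<in> C" "M \<in> C" and KL: "K \<inter> L = {x}" and LM: "L \<inter> M = {y}" and KM: "K \<inter> M = {z}"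
  shows "x = y"
proof (rule ccontr)
  assume "x \<noteq> y"
  have x: "x \<in> L" "x \<notin> M" using KL LM \<open>x \<noteq> y\<close> by auto
  have "tangent_at x L K" using KL by (auto simp: tangent_at_def)
  then have "K = L"
    using axiom_C_unique[OF assms(2,3) x assms(1) _ KM assms(2) tangent_at_refl[OF x(1)] LM] by simp
  moreover have "y \<in> L" using LM by auto
  ultimately have "y \<in> K \<inter> L" by simp
  then show False using KL \<open>x \<noteq> y\<close> by simp
qed

lemma axiom_S_circle:
  assumes "K \<in> C" "L \<in> C" "M \<in> C" "N \<in> C" "K \<inter> L = {a}" "L \<inter> M = {b}" "M \<inter> N = {c}" "N \<inter> K = {d}" "\<not> par a c"
  obtains Z where "Z \<in> C" "a \<in> Z" "b \<in> Z" "c \<in> Z" "d \<in> Z"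
  using S[unfolded axiom_S_def, rule_format, of K L M N a b c d] assms by auto

text \<open>A circle through the four contact points would contain the distinct parallel points
  \<open>b\<close> and \<open>d\<close>. In this form (S) proves that points are parallel.\<close>

lemma axiom_S_par:
  assumes "K \<in> C" "L \<in> C" "M \<in> C" "N \<in> C" "K \<inter> L = {a}" "L \<inter> M = {b}" "M \<inter> N = {c}" "N \<inter> K = {d}"
    and "par b d" "b \<noteq> d"
  shows "par a c"
proof (rule ccontr)
  assume "\<not> par a c"
  then obtain Z where Z: "Z \<in> C" "b \<in> Z" "d \<in> Z" using axiom_S_circle[OF assms(1-8)] by metis
  show False using par_on_circle[OF Z assms(9)] assms(10) by simp
qed

section \<open>Sufficiently many points and generators\<close>

lemma off_circle: "K \<in> C \<Longrightarrow> \<exists>z. z \<notin> K"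
proof -
  assume K: "K \<in> C"
  obtain K0 a b c where K0: "K0 \<in> C" "a \<in> K0" "b \<in> K0" "c \<in> K0" "a \<noteq> b" "b \<noteq> c" "a \<noteq> c" "K0 \<noteq> UNIV"
    using rich by blast
  show ?thesis
  proof (rule ccontr)
    assume "\<not> (\<exists>z. z \<notin> K)"
    then have "K = UNIV" by blast
    then show False using circle_eq[OF K K0(1), of a b c] K0 by auto
  qed
qed

lemma third_generator: "\<exists>z. \<not> par z x \<and> \<not> par z y"
proof -
  obtain K0 a b c where K0: "K0 \<in> C" "a \<in> K0" "b \<in> K0" "c \<in> K0" "a \<noteq> b" "b \<noteq> c" "a \<noteq> c"
    using rich by blast
  then have "\<not> par a b" "\<not> par b c" "\<not> par a c" using par_on_circle[OF K0(1)] by metis+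
  then have "\<not> (par a v \<and> par b v)" "\<not> (par b v \<and> par c v)" "\<not> (par a v \<and> par c v)" for v
    using par_trans[OF _ par_sym] by metis+
  then show ?thesis by metis
qed

text \<open>With three generators only, the circles \<open>K'\<close> and \<open>L\<close> through
  \<open>w\<close> that are tangent to \<open>K\<close> at \<open>x\<close> and at \<open>y\<close>
  have no generator left for a second common point. Then \<open>K\<close> and \<open>K'\<close> both
  lie in the pencil at \<open>x\<close> and touch \<open>L\<close>, against (C).\<close>

lemma fourth_generator: "\<exists>w. \<not> par w x \<and> \<not> par w y \<and> \<not> par w z"
proof (rule ccontr)
  assume neg: "\<not> ?thesis"
  then have xyz: "par w x \<or> par w y \<or> par w z" for w by blast
  have ne: "\<not> par x y" "\<not> par y z" "\<not> par x z"
    using third_generator[of x z] third_generator[of x y] neg par_trans par_sym by meson+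
  have *: False if K: "K \<in> C" "x \<in> K" "y \<in> K" "z \<in> K" "x \<noteq> y" "y \<noteq> z" "x \<noteq> z"
    and w: "w \<notin> K" "par w z" and xyz: "\<And>w. par w x \<or> par w y \<or> par w z" for K x y z w
  proof -
    have np: "\<not> par x z" "\<not> par y z" using par_on_circle[OF K(1)] K by metis+
    then have nw: "\<not> par x w" "\<not> par y w" using par_trans[OF _ w(2)] by metis+
    obtain L where L: "L \<in> C" "w \<in> L" "tangent_at y K L" using tangent_ex[OF K(1,3) nw(2)] by blast
    obtain K' where K': "K' \<in> C" "w \<in> K'" "tangent_at x K K'" using tangent_ex[OF K(1,2) nw(1)] by blast
    have KL: "K \<inter> L = {y}" and KK': "K \<inter> K' = {x}"
      using tangent_at_cases[OF L(3)] tangent_at_cases[OF K'(3)] L K' w by auto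
    have "K' \<inter> L = {w}"
    proof
      show "K' \<inter> L \<subseteq> {w}"
      proof
        fix v assume v: "v \<in> K' \<inter> L"
        have "x \<in> K'" "y \<in> L" using KK' KL by auto
        consider "par v x" | "par v y" | "par v z" using xyz by blast
        then show "v \<in> {w}"
        proof cases
          case 1
          then have "v = x" using par_on_circle[OF K'(1), of v x] v \<open>x \<in> K'\<close> by simp
          then show ?thesis using v KL K by auto
        next
          case 2
          then have "v = y" using par_on_circle[OF L(1), of v y] v \<open>y \<in> L\<close> by simp
          then show ?thesis using v KK' K by auto
        next
          case 3
          then have "par v w" using par_trans[OF _ par_sym[OF w(2)]] by simp
          then show ?thesis using par_on_circle[OF L(1), of v w] L v by simp
        qed
      qed
    qed (use K' L in simp)
    moreover have "x \<notin> L" using KL K by auto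
    ultimately have "K = K'"
      using axiom_C_unique[OF K(1) L(1) K(2) _ K(1) tangent_at_refl[OF K(2)] KL K'(1,3)] by simp
    then show False using w K' by simp
  qed
  obtain K where K: "K \<in> C" "x \<in> K" "y \<in> K" "z \<in> K" using circle_ex[OF ne] by auto
  have d: "x \<noteq> y" "y \<noteq> z" "x \<noteq> z" using ne by auto
  obtain w where w: "w \<notin> K" using off_circle K by blast
  consider "par w x" | "par w y" | "par w z" using xyz by blast
  then show False
  proof cases
    case 1
    show False by (rule *[of K y z x w]) (use K d w 1 xyz in metis)+
  next
    case 2
    show False by (rule *[of K x z y w]) (use K d w 2 xyz in metis)+
  next
    case 3
    show False by (rule *[of K x y z w]) (use K d w 3 xyz in metis)+
  qed
qed

text \<open>Either \<open>w\<close> itself is parallel to \<open>x\<close>, or a circle through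
  \<open>w\<close> tangent to \<open>K\<close> at another point than \<open>x\<close> meets the
  generator of \<open>x\<close> off \<open>K\<close>.\<close>

lemma other_parallel: "\<exists>y. par y x \<and> y \<noteq> x"
proof -
  obtain z where z: "\<not> par z x" using third_generator by blast
  obtain y where y: "\<not> par y x" "\<not> par y z" using third_generator by blast
  obtain K where K: "K \<in> C" "z \<in> K" "x \<in> K" "y \<in> K"
    using circle_ex[of z x y] z y par_sym by metis
  obtain w where w: "w \<notin> K" using off_circle K by blast
  have *: ?thesis if u: "u \<in> K" "u \<noteq> x" "\<not> par u w" "\<not> par x w" for u
  proof -
    obtain L where L: "L \<in> C" "w \<in> L" "tangent_at u K L" using tangent_ex[OF K(1) u(1,3)] by auto
    then have "x \<notin> L" using K u w tangent_at_eq by metis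
    then show ?thesis using proj[OF L(1), of x] by metis
  qed
  show ?thesis
  proof (cases "par x w")
    case True
    then show ?thesis using w K par_sym by metis
  next
    case False
    have "\<not> par y w \<or> \<not> par z w" using y par_trans par_sym by metis
    moreover have "y \<noteq> x" "z \<noteq> x" using y z by auto
    ultimately show ?thesis using *[of y] *[of z] K False by metis
  qed
qed

text \<open>Two pencils with distinct carriers \<open>s\<close>, \<open>t\<close> on \<open>Z\<close> make opposite angles with \<open>Z\<close> if their circles through a
  third point \<open>r\<close> of \<open>Z\<close> are tangent there; this does not depend on \<open>r\<close>.\<close>

lemma matched_pencils:
  assumes Z: "Z \<in> C" "s \<in> Z" "t \<in> Z" "r \<in> Z" "r' \<in> Z"
    and ne: "s \<noteq> t" "r \<noteq> s" "r \<noteq> t" "r' \<noteq> s" "r' \<noteq> t"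
    and D: "D \<in> C" "r \<in> D" and D': "D' \<in> C" "r' \<in> D'" and DD: "tangent_at s D D'"
    and E: "E \<in> C" "r \<in> E" and E': "E' \<in> C" "r' \<in> E'" and EE: "tangent_at t E E'"
    and DE: "tangent_at r D E" and DZ: "D \<noteq> Z"
  shows "tangent_at r' D' E'"
proof (cases "r = r'")
  case True
  have s: "s \<in> D" "s \<in> D'" "t \<in> E" "t \<in> E'" using tangent_atD[OF DD] tangent_atD[OF EE] by simp_all
  have "D = D'" using tangent_at_eq[OF DD] True D D' ne by auto
  moreover have "E = E'" using tangent_at_eq[OF EE] True E E' ne by auto
  ultimately show ?thesis using DE True by auto
next
  case rr: False
  have s: "s \<in> D" "s \<in> D'" "t \<in> E" "t \<in> E'" using tangent_atD[OF DD] tangent_atD[OF EE] by simp_all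
  have DmZ: "D \<inter> Z = {s, r}" using circle_meet[OF D(1) Z(1) s(1) D(2) Z(2,4)] ne DZ by simp
  have "D \<noteq> E" using s ne DmZ Z by auto
  then have DE1: "D \<inter> E = {r}" using tangent_at_cases[OF DE] by simp
  have "E \<noteq> Z" using DE1 s Z ne by auto
  then have EmZ: "E \<inter> Z = {t, r}" using circle_meet[OF E(1) Z(1) s(3) E(2) Z(3,4)] ne by simp
  have "E \<noteq> E'" using EmZ E' Z ne rr by auto
  then have EE1: "E \<inter> E' = {t}" using tangent_at_cases[OF EE] by simp
  have "E' \<noteq> Z" using EE1 E Z ne by auto
  then have E'mZ: "E' \<inter> Z = {t, r'}" using circle_meet[OF E'(1) Z(1) s(4) E'(2) Z(3,5)] ne by simp
  \<comment> \<open>\<open>F\<close> is taken from the pencil of \<open>D\<close> at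
    \<open>s\<close> and touches \<open>E'\<close> in \<open>w\<close>. Axiom (S) for the cycle
    \<open>E\<close>, \<open>E'\<close>, \<open>F\<close>, \<open>D\<close> puts \<open>w\<close> on
    \<open>Z\<close>; as \<open>w = t\<close> would give a tangent triangle, \<open>w = r'\<close>
    and \<open>F = D'\<close>.\<close>
  have "s \<notin> E'" using E'mZ Z ne by auto
  then obtain F w where F: "F \<in> C" "tangent_at s D F" "F \<inter> E' = {w}"
    using axiom_C_ex[OF D(1) E'(1) s(1)] by auto
  have "F \<noteq> D" using tangent_triple[OF D(1) E(1) E'(1) DE1 EE1] F(3) ne by auto
  then have FD: "F \<inter> D = {s}" using tangent_at_cases[OF F(2)] by auto
  obtain Y where Y: "Y \<in> C" "t \<in> Y" "w \<in> Y" "s \<in> Y" "r \<in> Y"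
  proof (rule axiom_S_circle[of E E' F D t w s r])
    show "\<not> par t s" using par_on_circle[OF Z(1,3,2)] ne by auto
  qed (use E E' F D EE1 FD DE1 in \<open>auto simp: Int_commute\<close>)
  have "Y = Z" using circle_eq[OF Y(1) Z(1), of t s r] Y Z ne by auto
  then have "w \<in> E' \<inter> Z" using F Y by auto
  then have "w = t \<or> w = r'" using E'mZ by auto
  moreover have "w \<noteq> t"
  proof
    assume "w = t"
    then have "tangent_at t E' F" using F tangent_atI by (metis Int_commute)
    then have tEF: "tangent_at t E F"
      using tangent_trans[OF E'(1) E(1) F(1) tangent_at_sym[OF EE]] by simp
    have "s \<notin> E" "s \<in> F" using EmZ Z ne FD by auto
    then have "E \<inter> F = {t}" using tangent_at_cases[OF tEF] by auto
    then have "s = r" using tangent_triple[OF F(1) D(1) E(1) FD DE1] by (auto simp: Int_commute)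
    then show False using ne by simp
  qed
  ultimately have w: "w = r'" by simp
  have "F = D'" using tangent_unique[OF D(1) F(1) D'(1) F(2) DD, of r'] F(3) w D' ne by auto
  then show ?thesis using F(3) w tangent_atI by simp
qed

text \<open>\<open>G\<close> is the circle of the pencil of \<open>L\<close> at \<open>p\<close>
  that touches \<open>M'\<close>. In the cycle \<open>L\<close>, \<open>M\<close>,
  \<open>M'\<close>, \<open>G\<close> the contact points \<open>u\<close> and \<open>p\<close> are
  parallel, so (S) makes \<open>g\<close> parallel to \<open>x\<close>; hence \<open>g = x'\<close>
  and \<open>G = L'\<close>.\<close>

lemma tangent_grid:
  assumes M: "M \<in> C" "M' \<in> C" "M \<inter> M' = {u}" and L: "L \<in> C" "L' \<in> C" "tangent_at p L L'"
    and up: "par u p" "u \<noteq> p" and x: "tangent_at x M L" "x' \<in> M'" "x' \<in> L'" "par x x'"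
  shows "tangent_at x' M' L'"
proof -
  have xM: "x \<in> M" "x \<in> L" using tangent_atD[OF x(1)] by simp_all
  have p: "p \<in> L" "p \<in> L'" using tangent_atD[OF L(3)] by simp_all
  have u: "u \<in> M" "u \<in> M'" using M by auto
  have pM: "p \<notin> M" "p \<notin> M'" using par_on_circle[OF M(1) u(1) _ up(1)] par_on_circle[OF M(2) u(2) _ up(1)] up(2) by auto
  have MmL: "M \<inter> L = {x}" using tangent_at_cases[OF x(1)] p pM by auto
  obtain G g where G: "G \<in> C" "tangent_at p L G" "G \<inter> M' = {g}"
    using axiom_C_ex[OF L(1) M(2) p(1) pM(2)] by auto
  have "par x g"
  proof (cases "G = L")
    case True
    then have "u = g" "u = x"
      using tangent_triple[of M M' L u g x] tangent_triple[of M' M L u x g] G MmL M L by (simp_all add: Int_commute)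
    then show ?thesis by simp
  next
    case False
    then have "L \<inter> G = {p}" using tangent_at_cases[OF G(2)] by auto
    then show ?thesis
      using axiom_S_par[of L M M' G x u g p] L M G MmL up by (auto simp: Int_commute)
  qed
  then have "par x' g" using par_trans[OF par_sym[OF x(4)]] by simp
  then have g: "g = x'" using par_on_circle[OF M(2), of x' g] G x by auto
  then have "x' \<noteq> p" using pM x by auto
  then have "G = L'" using tangent_unique[OF L(1) G(1) L(2) G(2) L(3), of x'] G g x by auto
  then show ?thesis using G g tangent_atI by (metis Int_commute)
qed

text \<open>\<open>M'\<close> is the image of \<open>M\<close> under a translation along the generators: it also translates the circles through \<open>p\<close>,
  which are lines of the derived affine plane at \<open>p\<close>.\<close>

lemma vertical_translation:
  assumes M: "M \<in> C" "M' \<in> C" "M \<inter> M' = {u}" and up: "par u p" "u \<noteq> p"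
    and s: "s \<in> M" "s' \<in> M'" "par s s'" "s \<noteq> u" and t: "t \<in> M" "t' \<in> M'" "par t t'" "t \<noteq> u" and st: "s \<noteq> t"
    and N: "N \<in> C" "p \<in> N" "s \<in> N" "t \<in> N" and N': "N' \<in> C" "p \<in> N'" "s' \<in> N'" "t' \<in> N'"
  shows "N \<inter> N' = {p}"
proof (rule ccontr)
  assume "N \<inter> N' \<noteq> {p}"
  then obtain r where r: "r \<in> N" "r \<in> N'" "r \<noteq> p" using N N' by blast
  have u: "u \<in> M" "u \<in> M'" using M by auto
  have pM: "p \<notin> M" "p \<notin> M'" using par_on_circle[OF M(1) u(1) _ up(1)] par_on_circle[OF M(2) u(2) _ up(1)] up(2) by auto
  have su: "\<not> par s u" "\<not> par t u" using par_on_circle[OF M(1) s(1) u(1)] par_on_circle[OF M(1) t(1) u(1)] s(4) t(4) by auto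
  have sp: "\<not> par s p" "\<not> par t p" using su up par_trans par_sym by meson+
  have ss': "s \<noteq> s'" "t \<noteq> t'" using M s t by auto
  have s't': "s' \<noteq> t'"
  proof
    assume "s' = t'"
    then have "par s t" using s t par_trans par_sym by meson
    then show False using par_on_circle[OF M(1) s(1) t(1)] st by simp
  qed
  have s'p: "\<not> par s' p" "\<not> par t' p" using sp par_trans[OF s(3)] par_trans[OF t(3)] by auto
  have rp: "\<not> par r p" using par_on_circle[OF N(1) r(1) N(2)] r by auto
  have rs: "\<not> par r s" "\<not> par r s'"
  proof -
    have iff: "par r s \<longleftrightarrow> par r s'" using s(3) par_trans par_sym by metis
    have "par r s \<Longrightarrow> r = s" using par_on_circle[OF N(1) r(1) N(3)] .
    moreover have "par r s' \<Longrightarrow> r = s'" using par_on_circle[OF N'(1) r(2) N'(3)] .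
    ultimately show "\<not> par r s" "\<not> par r s'" using ss' iff by auto
  qed
  \<comment> \<open>A second common point \<open>r\<close> of \<open>N\<close> and \<open>N'\<close>
    is to be refuted. The circles \<open>V\<close> and \<open>V'\<close> through \<open>r\<close>,
    tangent to \<open>M\<close> at \<open>s\<close> and to \<open>M'\<close> at \<open>s'\<close>,
    both touch \<open>J\<close> at \<open>r\<close>, by \<open>matched_pencils\<close> along
    \<open>N\<close> and along \<open>N'\<close>; so they touch each other.\<close>
  obtain L where L: "L \<in> C" "p \<in> L" "tangent_at t M L" using tangent_ex[OF M(1) t(1) sp(2)] by auto
  obtain L' where L': "L' \<in> C" "t' \<in> L'" "tangent_at p L L'"
    using tangent_ex[OF L(1,2), of t'] s'p(2) par_sym[of p t'] by auto
  have tL': "tangent_at t' M' L'"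
    using tangent_grid[OF M L(1) L'(1,3) up L(3) t(2) L'(2) t(3)] .
  obtain J where J: "J \<in> C" "r \<in> J" "tangent_at p L J"
    using tangent_ex[OF L(1,2), of r] rp par_sym[of p r] by auto
  have J': "tangent_at p L' J" using tangent_trans[OF L(1) L'(1) J(1) L'(3) J(3)] .
  obtain V where V: "V \<in> C" "r \<in> V" "tangent_at s M V" using tangent_ex[OF M(1) s(1), of r] rs par_sym[of s r] by auto
  obtain V' where V': "V' \<in> C" "r \<in> V'" "tangent_at s' M' V'"
    using tangent_ex[OF M(2) s(2), of r] rs par_sym[of s' r] by auto
  have MN: "M \<noteq> N" "M' \<noteq> N'" using pM N N' by auto
  have ne: "s \<noteq> p" "t \<noteq> p" "r \<noteq> s" "r \<noteq> s'" "s' \<noteq> p" "t' \<noteq> p" using sp rs s'p by auto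
  have 1: "tangent_at r V J"
    using matched_pencils[OF N(1,3,2,4) r(1) _ _ _ _ r(3) M(1) t(1) V L(1) tangent_atD(2)[OF L(3)] J L(3) MN(1)]
      ne st by simp
  have 2: "tangent_at r V' J"
    using matched_pencils[OF N'(1,3,2,4) r(2) _ _ _ _ r(3) M(2) t(2) V' L'(1,2) J(1,2) J' tL' MN(2)]
      ne s't' by simp
  have 3: "tangent_at r V V'" using tangent_trans[OF J(1) V(1) V'(1) tangent_at_sym[OF 1] tangent_at_sym[OF 2]] .
  have sV: "s \<in> V" "s' \<in> V'" using tangent_atD[OF V(3)] tangent_atD[OF V'(3)] by simp_all
  have "V \<noteq> V'" using par_on_circle[OF V(1), of s s'] s ss' sV by auto
  then have VV: "V \<inter> V' = {r}" using tangent_at_cases[OF 3] by simp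
  have s'M: "s' \<notin> M" using par_on_circle[OF M(1), of s s'] s ss' by auto
  have ru: "\<not> par r u" using rp par_trans[OF _ up(1)] by auto
  \<comment> \<open>In the cycle \<open>M\<close>, \<open>M'\<close>, \<open>V'\<close>,
    \<open>V\<close> the contact points \<open>s'\<close> and \<open>s\<close> are parallel, so (S)
    makes \<open>u\<close> and \<open>r\<close> parallel. The first case treats coinciding circles,
    where \<open>tangent_triple\<close> replaces (S).\<close>
  show False
  proof (cases "M = V \<or> M' = V'")
    case True
    have "r = u"
    proof (cases "M = V")
      case MV: True
      show ?thesis
      proof (cases "M' = V'")
        case True then show ?thesis using MV VV M by auto
      next
        case False
        then have "M' \<inter> V' = {s'}" using tangent_at_cases[OF V'(3)] by simp
        then have "s' = u" using tangent_triple[of V' M' M s' u r] V' M VV MV by (auto simp: Int_commute)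
        then show ?thesis using u s'M by simp
      qed
    next
      case False
      then have "M \<inter> V = {s}" using tangent_at_cases[OF V(3)] by simp
      then have "s = u" using tangent_triple[of V M M' s u r] V M VV True False by (auto simp: Int_commute)
      then show ?thesis using s by simp
    qed
    then show False using ru by simp
  next
    case False
    then have "M \<inter> V = {s}" "M' \<inter> V' = {s'}" using tangent_at_cases[OF V(3)] tangent_at_cases[OF V'(3)] by simp_all
    then have "par u r"
      using axiom_S_par[of M M' V' V u s' r s] M V V' VV s ss' par_sym by (auto simp: Int_commute)
    then show False using ru par_sym[of u r] by simp
  qed
qed


section \<open>Construction of the translations\<close>

lemma circle_ex2: "\<not> par x y \<Longrightarrow> \<exists>K\<in>C. x \<in> K \<and> y \<in> K"
  using circle_ex third_generator par_sym by metis

lemma circle_through: "\<exists>K\<in>C. x \<in> K"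
  using circle_ex2 third_generator par_sym by metis

text \<open>These are the translations of the derived affine plane at \<open>p\<close> in the
  direction of the generators; in the model, addition of a multiple of
  \<open>(X - p)^2\<close>.\<close>

definition transl :: "'p \<Rightarrow> ('p \<Rightarrow> 'p) \<Rightarrow> bool" where
  "transl p f \<longleftrightarrow> bij f \<and> (\<forall>z. par (f z) z) \<and> (\<forall>M\<in>C. f ` M \<in> C \<and> tangent_at (proj M p) M (f ` M))"

text \<open>This is the condition that a translation taking \<open>a\<close> to \<open>a'\<close>
  must take \<open>z\<close> to \<open>z'\<close>. One pair of circles suffices as a witness, since
  \<open>shift_all\<close> transfers it to every other pair.\<close>

definition shift :: "'p \<Rightarrow> 'p \<Rightarrow> 'p \<Rightarrow> 'p \<Rightarrow> 'p \<Rightarrow> bool" where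
  "shift p a a' z z' \<longleftrightarrow> par a a' \<and> par z z' \<and> (\<exists>M\<in>C. \<exists>M'\<in>C. a \<in> M \<and> z \<in> M \<and> a' \<in> M' \<and> z' \<in> M' \<and>
     tangent_at (proj M p) M M')"

lemma shift_sym: "shift p a a' z z' \<Longrightarrow> shift p z z' a a'"
  unfolding shift_def by blast

lemma proj_tangent: "M \<in> C \<Longrightarrow> M' \<in> C \<Longrightarrow> tangent_at (proj M p) M M' \<Longrightarrow> proj M' p = proj M p"
  using proj_eq proj tangent_atD by metis

lemma shift_flip: "shift p a a' z z' \<Longrightarrow> shift p a' a z' z"
  unfolding shift_def using proj_tangent tangent_at_sym par_sym by metis

text \<open>Two circles through \<open>a\<close> and \<open>z\<close> coincide if they meet the
  generator of \<open>p\<close> in the same point; otherwise \<open>vertical_translation\<close>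
  compares their images.\<close>

lemma shift_all:
  assumes sh: "shift p a a' z z'" and np: "\<not> par a p" "\<not> par z p" "\<not> par a z"
    and M: "M \<in> C" "a \<in> M" "z \<in> M" "M' \<in> C" "a' \<in> M'" "tangent_at (proj M p) M M'"
  shows "z' \<in> M'"
proof -
  obtain K K' where K: "K \<in> C" "K' \<in> C" "a \<in> K" "z \<in> K" "a' \<in> K'" "z' \<in> K'" "tangent_at (proj K p) K K'"
    and pa: "par a a'" "par z z'" using sh unfolding shift_def by blast
  let ?u = "proj K p" and ?v = "proj M p"
  have u: "?u \<in> K" "par ?u p" and v: "?v \<in> M" "par ?v p" using proj K M by blast+
  have np': "\<not> par a' p" "\<not> par z' p" "\<not> par a' z'"
    using np pa par_trans par_sym by meson+
  have anu: "a \<noteq> ?u" "z \<noteq> ?u" "a' \<noteq> ?u" "z' \<noteq> ?u" "a \<noteq> ?v" "z \<noteq> ?v" "a' \<noteq> ?v" "z' \<noteq> ?v" "a \<noteq> z"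
    using u v np np' by auto
  show ?thesis
  proof (cases "?u = ?v")
    case True
    then have "K = M" using circle_eq[OF K(1) M(1), of a z ?u] K M u v anu by auto
    then have "K' = M'" using tangent_unique[OF M(1) K(2) M(4), of ?v a'] K M anu by auto
    then show ?thesis using K by simp
  next
    case uv: False
    show ?thesis
    proof (cases "K = K'")
      case True
      then have "a = a'" "z = z'"
        using par_on_circle[OF K(1,3) _ pa(1)] par_on_circle[OF K(1,4) _ pa(2)] K(5,6) by simp_all
      then show ?thesis using tangent_at_eq[OF M(6)] M anu by metis
    next
      case False
      then have KK: "K \<inter> K' = {?u}" using tangent_at_cases[OF K(7)] by simp
      have puv: "par ?u ?v" using u v par_trans par_sym by meson
      have "\<not> par ?v a'" "\<not> par a' z'" "\<not> par ?v z'" using np' v par_trans par_sym by meson+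
      then obtain N where N: "N \<in> C" "?v \<in> N" "a' \<in> N" "z' \<in> N" using circle_ex by blast
      have "M \<inter> N = {?v}"
        by (rule vertical_translation[OF K(1,2) KK puv uv K(3,5) pa(1) anu(1) K(4,6) pa(2) anu(2) anu(9)
              M(1) v(1) M(2,3) N])
      then have "N = M'" using tangent_unique[OF M(1) N(1) M(4) tangent_atI M(6) N(3) M(5)] anu by blast
      then show ?thesis using N by simp
    qed
  qed
qed

lemma shift_ex:
  assumes "\<not> par a p" "\<not> par z p" "\<not> par a z" "par a a'"
  shows "\<exists>z'. shift p a a' z z'"
proof -
  obtain M where M: "M \<in> C" "a \<in> M" "z \<in> M" using circle_ex2 assms by blast
  have "\<not> par (proj M p) a'" using proj[OF M(1), of p] assms par_trans par_sym by meson
  then obtain M' where M': "M' \<in> C" "a' \<in> M'" "tangent_at (proj M p) M M'"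
    using tangent_ex[OF M(1) proj(1)[OF M(1)]] by blast
  then have "shift p a a' z (proj M' z)" unfolding shift_def using M assms proj[OF M'(1), of z] par_sym by blast
  then show ?thesis by blast
qed

lemma shift_unique:
  assumes "shift p a a' z z'" "shift p a a' z z''" "\<not> par a p" "\<not> par z p" "\<not> par a z"
  shows "z' = z''"
proof -
  obtain M M' where M: "M \<in> C" "M' \<in> C" "a \<in> M" "z \<in> M" "a' \<in> M'" "z' \<in> M'" "tangent_at (proj M p) M M'"
    using assms(1) unfolding shift_def by blast
  then have "z'' \<in> M'" using shift_all[OF assms(2-5)] by blast
  moreover have "par z' z''" using assms unfolding shift_def using par_trans par_sym by meson
  ultimately show ?thesis using par_on_circle M by blast
qed

lemma shift_trans:
  assumes ab: "shift p a a' b b'" and az: "shift p a a' z z'"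
    and np: "\<not> par a p" "\<not> par b p" "\<not> par z p" "\<not> par a b" "\<not> par a z" "\<not> par b z"
  shows "shift p b b' z z'"
proof -
  obtain M where M: "M \<in> C" "a \<in> M" "b \<in> M" "z \<in> M" using circle_ex np by blast
  have pa: "par a a'" "par b b'" "par z z'" using ab az unfolding shift_def by blast+
  have "\<not> par (proj M p) a'" using proj[OF M(1), of p] np pa par_trans par_sym by meson
  then obtain M' where M': "M' \<in> C" "a' \<in> M'" "tangent_at (proj M p) M M'"
    using tangent_ex[OF M(1) proj(1)[OF M(1)]] by blast
  have "b' \<in> M'" using shift_all[OF ab np(1,2,4) M(1,2,3) M'] .
  moreover have "z' \<in> M'" using shift_all[OF az np(1,3,5) M(1,2,4) M'] .
  ultimately show ?thesis unfolding shift_def using M M' pa by blast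
qed

lemma transl_ex:
  assumes ap: "\<not> par a p" and aa: "par a a'"
  shows "\<exists>f. transl p f \<and> f a = a'"
proof -
  obtain b where b: "\<not> par b a" "\<not> par b p" using third_generator by blast
  then have ba: "\<not> par a b" using par_sym by blast
  obtain b' where b': "shift p a a' b b'" using shift_ex[OF ap b(2) ba aa] by blast
  \<comment> \<open>The pair \<open>a\<close>, \<open>a'\<close> determines the map only off the
    generator of \<open>a\<close>; on that generator the pair \<open>b\<close>, \<open>b'\<close>
    takes over.\<close>
  define f where "f z = (if par z p then z else if par z a then THE z'. shift p b b' z z'
    else THE z'. shift p a a' z z')" for z
  have fp: "f z = z" if "par z p" for z using that by (simp add: f_def)
  have f1: "shift p a a' z (f z)" if z: "\<not> par z p" "\<not> par z a" for z
  proof -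
    have az: "\<not> par a z" using z par_sym by blast
    obtain z' where z': "shift p a a' z z'" using shift_ex[OF ap z(1) az aa] by blast
    then have "(THE z'. shift p a a' z z') = z'"
      using shift_unique[OF _ _ ap z(1) az] by (intro the_equality) blast+
    then show ?thesis using z z' by (simp add: f_def)
  qed
  have f2: "shift p b b' z (f z)" if z: "\<not> par z p" "par z a" for z
  proof -
    have bz: "\<not> par b z" using z b par_trans by blast
    have bb: "par b b'" using b' unfolding shift_def by blast
    obtain z' where z': "shift p b b' z z'" using shift_ex[OF b(2) z(1) bz bb] by blast
    then have "(THE z'. shift p b b' z z') = z'"
      using shift_unique[OF _ _ b(2) z(1) bz] by (intro the_equality) blast+
    then show ?thesis using z z' by (simp add: f_def)
  qed
  have fa: "f a = a'" using shift_unique[OF f2[OF ap par_refl] shift_sym[OF b'] b(2) ap b(1)] .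
  have mixed: "shift p y (f y) z (f z)" if y: "\<not> par y p" "par y a" and z: "\<not> par z p" "\<not> par z a" for y z
  proof -
    have az: "\<not> par a z" and yz: "\<not> par y z" and "\<not> par b y" and yb: "\<not> par y b"
      using z y b par_sym par_trans by meson+
    show ?thesis
    proof (cases "par z b")
      case False
      then have bz: "\<not> par b z" using par_sym by blast
      have "shift p b b' z (f z)" using shift_trans[OF b' f1[OF z] ap b(2) z(1) ba az bz] .
      then show ?thesis using shift_trans[OF f2[OF y] _ b(2) y(1) z(1) \<open>\<not> par b y\<close> bz yz] by blast
    next
      case True
      \<comment> \<open>Here \<open>y\<close> was defined through \<open>b\<close> and
        \<open>z\<close> through \<open>a\<close>, but \<open>z\<close> lies on the generator of
        \<open>b\<close>. A point \<open>d\<close> on a fourth generator serves as intermediate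
        reference.\<close>
      obtain d where d: "\<not> par d a" "\<not> par d b" "\<not> par d p" using fourth_generator by blast
      have ad: "\<not> par a d" and dz: "\<not> par d z" and bd: "\<not> par b d" and dy: "\<not> par d y"
        using d True y par_sym par_trans by meson+
      have 1: "shift p d (f d) z (f z)" using shift_trans[OF f1[OF d(3,1)] f1[OF z] ap d(3) z(1) ad az dz] .
      have 2: "shift p b b' d (f d)" using shift_trans[OF b' f1[OF d(3,1)] ap b(2) d(3) ba ad bd] .
      have 3: "shift p d (f d) y (f y)" using shift_trans[OF 2 f2[OF y] b(2) d(3) y(1) bd \<open>\<not> par b y\<close> dy] .
      show ?thesis using shift_trans[OF 3 1 d(3) y(1) z(1) dy dz yz] .
    qed
  qed
  have key: "shift p y (f y) z (f z)" if "\<not> par y p" "\<not> par z p" "\<not> par y z" for y z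
  proof (cases "par y a")
    case True
    then have "\<not> par z a" using that par_trans par_sym by meson
    then show ?thesis using mixed that True by blast
  next
    case False
    show ?thesis
    proof (cases "par z a")
      case True
      then show ?thesis using mixed shift_sym that False by blast
    next
      case za: False
      then have "\<not> par a y" "\<not> par a z" using False par_sym by blast+
      then show ?thesis using shift_trans[OF f1 f1] that False za ap by blast
    qed
  qed
  have fpar: "par (f z) z" for z
  proof (cases "par z p")
    case False
    obtain c where "\<not> par c z" "\<not> par c p" using third_generator by blast
    then have "shift p c (f c) z (f z)" using key False by blast
    then show ?thesis unfolding shift_def using par_sym by blast
  qed (simp add: fp)
  have im: "f ` M \<in> C \<and> tangent_at (proj M p) M (f ` M)" if M: "M \<in> C" for M
  proof -
    let ?u = "proj M p"
    have u: "?u \<in> M" "par ?u p" using proj M by blast+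
    obtain y0 where y0: "\<not> par y0 p" using third_generator by blast
    let ?y = "proj M y0"
    have y: "?y \<in> M" "\<not> par ?y p" using proj[OF M, of y0] y0 par_trans par_sym by meson+
    have "\<not> par ?u (f ?y)" using y u fpar par_trans par_sym by meson
    then obtain M' where M': "M' \<in> C" "f ?y \<in> M'" "tangent_at ?u M M'" using tangent_ex[OF M u(1)] by blast
    have in': "f z \<in> M'" if z: "z \<in> M" for z
    proof -
      consider "z = ?u" | "z = ?y" | "z \<noteq> ?u" "z \<noteq> ?y" by blast
      then show ?thesis
      proof cases
        case 1 then show ?thesis using fp u M' tangent_atD by simp
      next
        case 2 then show ?thesis using M' by simp
      next
        case 3
        then have zz: "\<not> par ?y z" using par_on_circle M z y by blast
        have "\<not> par z ?u" using 3 par_on_circle M z u by blast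
        then have zp: "\<not> par z p" using u par_trans par_sym by meson
        show ?thesis using shift_all[OF key[OF y(2) zp zz] y(2) zp zz M y(1) z M'] .
      qed
    qed
    have "f ` M = M'"
    proof
      show "M' \<subseteq> f ` M"
      proof
        fix m assume m: "m \<in> M'"
        have "f (proj M m) \<in> M'" "par (f (proj M m)) m"
          using in'[OF proj(1)[OF M]] par_trans[OF fpar proj(2)[OF M]] by simp_all
        then have "f (proj M m) = m" using par_on_circle[OF M'(1) _ m] by simp
        then show "m \<in> f ` M" using proj(1)[OF M, of m] by force
      qed
    qed (use in' in blast)
    then show ?thesis using M' by simp
  qed
  have "inj f"
  proof
    fix y z assume yz: "f y = f z"
    then have pyz: "par y z" using fpar par_trans par_sym by metis
    show "y = z"
    proof (cases "par z p")
      case True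
      then have "par y p" using pyz par_trans by blast
      then show ?thesis using True yz fp by simp
    next
      case False
      obtain c where c: "\<not> par c z" "\<not> par c p" using third_generator by blast
      have yp: "\<not> par y p" "\<not> par c y" using False c pyz par_trans par_sym by meson+
      have 1: "shift p (f c) c (f z) z" using key shift_flip c False by blast
      have 2: "shift p (f c) c (f z) y" using key[of c y] shift_flip c yp yz by metis
      have "\<not> par (f c) p" "\<not> par (f z) p" "\<not> par (f c) (f z)"
        using fpar[of c] fpar[of z] c False par_trans par_sym by meson+
      then show ?thesis using shift_unique[OF 2 1] by blast
    qed
  qed
  moreover have "surj f"
    unfolding surj_def
  proof
    fix y
    show "\<exists>x. y = f x"
    proof (cases "par y p")
      case True then show ?thesis using fp by metis
    next
      case False
      obtain c where c: "\<not> par c y" "\<not> par c p" using third_generator by blast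
      have fc: "\<not> par (f c) p" "\<not> par (f c) y" "par (f c) c"
        using fpar[of c] c False par_trans par_sym by meson+
      obtain x where x: "shift p (f c) c y x" using shift_ex[OF fc(1) False fc(2,3)] by blast
      then have yx: "par y x" unfolding shift_def by blast
      have cx: "\<not> par x p" "\<not> par c x" using yx c False par_trans par_sym by meson+
      have "y = f x" using shift_unique[OF shift_flip[OF x] key[OF c(2) cx(1,2)] c(2) cx] .
      then show ?thesis by blast
    qed
  qed
  ultimately have "transl p f" unfolding transl_def using fpar im by (auto simp: bij_def)
  then show ?thesis using fa by blast
qed

lemma transl_par: "transl p f \<Longrightarrow> par (f z) z"
  unfolding transl_def by blast

lemma transl_bij: "transl p f \<Longrightarrow> bij f"
  unfolding transl_def by blast

lemma transl_circle: "transl p f \<Longrightarrow> M \<in> C \<Longrightarrow> f ` M \<in> C"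
  unfolding transl_def by blast

lemma transl_tangent: "transl p f \<Longrightarrow> M \<in> C \<Longrightarrow> tangent_at (proj M p) M (f ` M)"
  unfolding transl_def by blast

lemma transl_fixes: assumes "transl p f" "par z p" shows "f z = z"
proof -
  obtain M where M: "M \<in> C" "z \<in> M" using circle_through by blast
  have "proj M p = z" using proj_eq M assms by blast
  then have "z \<in> f ` M" using transl_tangent[OF assms(1) M(1)] tangent_atD by metis
  then show ?thesis using par_on_circle[OF transl_circle[OF assms(1) M(1)], of "f z" z] transl_par[OF assms(1)] M by blast
qed

lemma par_map_image:
  assumes "M \<in> C" "f ` M \<in> C" "\<And>z. par (f z) z" "z \<in> M"
  shows "f z = proj (f ` M) z"
  using proj_eq[OF assms(2), of "f z" z] assms by auto

lemma transl_unique: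
  assumes f: "transl p f" and g: "transl p g" and fa: "f a = g a" and ap: "\<not> par a p"
  shows "f = g"
proof -
  have *: "f z = g z" if fa: "f a = g a" and az: "\<not> par a z" and ap: "\<not> par a p" for a z
  proof -
    obtain M where M: "M \<in> C" "a \<in> M" "z \<in> M" using circle_ex2 az by blast
    have "f a \<noteq> proj M p" using transl_par[OF f, of a] proj[OF M(1), of p] ap par_trans par_sym by metis
    then have "f ` M = g ` M"
      using tangent_unique[OF M(1) transl_circle[OF f M(1)] transl_circle[OF g M(1)]
        transl_tangent[OF f M(1)] transl_tangent[OF g M(1)], of "f a"] M fa by blast
    then show ?thesis
      using par_map_image[OF M(1) transl_circle[OF f M(1)]] par_map_image[OF M(1) transl_circle[OF g M(1)]]
        transl_par f g M by metis
  qed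
  show ?thesis
  proof
    fix z
    show "f z = g z"
    proof (cases "par a z")
      case False then show ?thesis using * fa ap by blast
    next
      case True
      obtain b where b: "\<not> par b a" "\<not> par b p" using third_generator by blast
      then have "f b = g b" using *[of a b] fa ap par_sym by blast
      moreover have "\<not> par b z" using True b par_trans par_sym by meson
      ultimately show ?thesis using * b by blast
    qed
  qed
qed

lemma transl_id: "transl p id"
  unfolding transl_def using tangent_at_refl[OF proj(1)] by simp

lemma transl_comp: assumes f: "transl p f" and g: "transl p g" shows "transl p (f \<circ> g)"
proof -
  have "tangent_at (proj M p) M ((f \<circ> g) ` M)" "(f \<circ> g) ` M \<in> C" if M: "M \<in> C" for M
  proof -
    have gM: "g ` M \<in> C" "tangent_at (proj M p) M (g ` M)" using g M transl_circle transl_tangent by blast+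
    have fgM: "f ` g ` M \<in> C" "tangent_at (proj M p) (g ` M) (f ` g ` M)"
      using transl_circle[OF f gM(1)] transl_tangent[OF f gM(1)] proj_tangent[OF M gM] by simp_all
    show "tangent_at (proj M p) M ((f \<circ> g) ` M)"
      using tangent_trans[OF gM(1) M fgM(1) tangent_at_sym[OF gM(2)] fgM(2)] by (simp add: image_comp)
    show "(f \<circ> g) ` M \<in> C" using fgM by (simp add: image_comp)
  qed
  moreover have "par ((f \<circ> g) z) z" for z
    using transl_par[OF f, of "g z"] transl_par[OF g, of z] par_trans by (metis comp_apply)
  ultimately show ?thesis unfolding transl_def using bij_comp transl_bij f g by blast
qed

text \<open>The inverse is recognized as the translation that carries one point \<open>?b\<close>
  back, because \<open>transl_unique\<close> makes the product with \<open>f\<close> the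
  identity.\<close>

lemma transl_inv: assumes f: "transl p f" shows "transl p (inv_into UNIV f)"
proof -
  have b: "bij f" using f transl_bij by blast
  have inv: "inv_into UNIV f (f z) = z" "f (inv_into UNIV f z) = z" for z using b by (simp_all add: bij_is_inj bij_is_surj surj_f_inv_f)
  have "inv_into UNIV f ` M \<in> C \<and> tangent_at (proj M p) M (inv_into UNIV f ` M)" if M: "M \<in> C" for M
  proof -
    obtain a where a: "\<not> par a p" using third_generator by blast
    let ?b = "proj M a"
    have b: "?b \<in> M" "\<not> par ?b p" using proj[OF M, of a] a par_trans par_sym by meson+
    have "par ?b (inv_into UNIV f ?b)" using transl_par[OF f, of "inv_into UNIV f ?b"] inv by simp
    then obtain g where g: "transl p g" "g ?b = inv_into UNIV f ?b" using transl_ex b by blast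
    have "f \<circ> g = id" using transl_unique[OF transl_comp[OF f g(1)] transl_id, of ?b] g inv b by simp
    then have "inv_into UNIV f = g" using inv by (metis comp_apply id_apply ext)
    then show ?thesis using g M unfolding transl_def by blast
  qed
  moreover have "par (inv_into UNIV f z) z" for z using transl_par[OF f, of "inv_into UNIV f z"] inv par_sym by metis
  ultimately show ?thesis unfolding transl_def using bij_imp_bij_inv b by blast
qed

lemma transl_cong: assumes "transl p f" "par p q" shows "transl q f"
proof -
  have "proj M p = proj M q" if "M \<in> C" for M
    using proj_eq[OF that proj(1)[OF that, of q], of p] proj(2)[OF that, of q] assms par_trans par_sym by meson
  then show ?thesis using assms unfolding transl_def by metis
qed

lemma same_on_circles:
  assumes "\<And>K. K \<in> C \<Longrightarrow> f ` K = g ` K" "\<And>K. K \<in> C \<Longrightarrow> f ` K \<in> C" "\<And>z. par (f z) z" "\<And>z. par (g z) z"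
  shows "f = g"
proof
  fix z
  obtain K where K: "K \<in> C" "z \<in> K" using circle_through by blast
  then show "f z = g z" using par_map_image[OF K(1)] assms by metis
qed

section \<open>Commutativity of translations\<close>

text \<open>The image of \<open>K\<close> under \<open>f \<circ> g\<close> touches its image under
  \<open>f\<close> at \<open>f ?x\<close> by \<open>tangent_grid\<close>; the image under
  \<open>g \<circ> f\<close> does so because \<open>g\<close> is a translation. Both contain
  \<open>g ?u\<close>, so they agree.\<close>

lemma transl_commute_distinct:
  assumes f: "transl p f" and g: "transl q g" and pq: "\<not> par p q"
  shows "f \<circ> g = g \<circ> f"
proof (rule same_on_circles)
  fix K assume K: "K \<in> C"
  show "(f \<circ> g) ` K \<in> C" using transl_circle[OF f transl_circle[OF g K]] by (simp add: image_comp)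
  let ?u = "proj K p" and ?x = "proj K q"
  have u: "?u \<in> K" "par ?u p" "?x \<in> K" "par ?x q" using proj K by blast+
  have fK: "f ` K \<in> C" "g ` K \<in> C" "f ` g ` K \<in> C" "g ` f ` K \<in> C" using f g K transl_circle by blast+
  show "(f \<circ> g) ` K = (g \<circ> f) ` K"
  proof (cases "f ` K = K \<or> g ?u = ?u")
    case True
    have "f = id \<or> g = id"
    proof (cases "f ` K = K")
      case True
      have "f ?x = ?x" using par_map_image[of K f ?x] True K u transl_par[OF f] proj_self by metis
      moreover have "\<not> par ?x p" using u pq par_trans par_sym by meson
      ultimately have "f = id" using transl_unique[OF f transl_id] by simp
      then show ?thesis by simp
    next
      case False
      then have "g ?u = ?u" using True by simp
      moreover have "\<not> par ?u q" using u pq par_trans par_sym by meson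
      ultimately have "g = id" using transl_unique[OF g transl_id] by simp
      then show ?thesis by simp
    qed
    then show ?thesis by auto
  next
    case False
    have KfK: "K \<inter> f ` K = {?u}" using transl_tangent[OF f K] tangent_at_cases False by metis
    have gu: "proj (g ` K) p = g ?u"
      using proj_eq[OF fK(2), of "g ?u" p] u transl_par[OF g, of ?u] par_trans by blast
    have 1: "tangent_at (g ?u) (g ` K) (f ` g ` K)" using transl_tangent[OF f fK(2)] gu by simp
    have fx: "par ?x (f ?x)" using transl_par[OF f] par_sym by blast
    have xfg: "f ?x \<in> f ` g ` K"
      using transl_fixes[OF g u(4)] u by (metis imageI)
    have 2: "tangent_at (f ?x) (f ` K) (f ` g ` K)"
      using tangent_grid[OF K fK(1) KfK fK(2,3) 1 _ _ transl_tangent[OF g K] _ xfg fx]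
        transl_par[OF g, of ?u] False u par_sym by auto
    have "proj (f ` K) q = f ?x"
      using proj_eq[OF fK(1), of "f ?x" q] u transl_par[OF f, of ?x] par_trans by blast
    then have 3: "tangent_at (f ?x) (f ` K) (g ` f ` K)" using transl_tangent[OF g fK(1)] by simp
    have "g ?u \<in> f ` g ` K" using tangent_atD(2)[OF 1] .
    moreover have "g ?u \<in> g ` f ` K" using transl_fixes[OF f u(2)] u by (metis imageI)
    moreover have "g ?u \<noteq> f ?x"
      using transl_par[OF f, of ?x] transl_par[OF g, of ?u] u pq par_trans par_sym by metis
    ultimately have "f ` g ` K = g ` f ` K"
      using tangent_unique[OF fK(1,3,4) 2 3] by blast
    then show ?thesis by (simp add: image_comp)
  qed
next
  show "par ((f \<circ> g) z) z" "par ((g \<circ> f) z) z" for z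
    using transl_par[OF f] transl_par[OF g] par_trans by (metis comp_apply)+
qed

text \<open>For a common fixed generator one compares \<open>f\<close> with translations \<open>h\<close> along other generators which agree with
  \<open>f\<close> on a given generator.\<close>

lemma transl_commute_same:
  assumes f: "transl p f" and g: "transl p g"
  shows "f \<circ> g = g \<circ> f"
proof
  fix a
  show "(f \<circ> g) a = (g \<circ> f) a"
  proof (cases "par a p")
    case True
    then show ?thesis using transl_fixes[OF f] transl_fixes[OF g] by simp
  next
    case False
    obtain q where q: "\<not> par q p" "\<not> par q a" using third_generator by blast
    obtain r where r: "\<not> par r p" "\<not> par r q" "\<not> par r a" using fourth_generator by blast
    have aq: "\<not> par a q" "\<not> par a r" using q r par_sym by blast+
    obtain h where h: "transl q h" "h a = f a" using transl_ex[OF aq(1)] transl_par[OF f] par_sym by blast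
    \<comment> \<open>\<open>k\<close> commutes with \<open>f\<close> and with \<open>h\<close>, so
      their agreement at \<open>a\<close> spreads over the whole generator of
      \<open>a\<close>.\<close>
    have "h y = f y" if y: "par a y" for y
    proof -
      obtain k where k: "transl r k" "k a = y" using transl_ex[OF aq(2) y] by blast
      have "h y = k (h a)" using transl_commute_distinct[OF h(1) k(1)] r k par_sym by (metis comp_apply)
      also have "\<dots> = f y" using transl_commute_distinct[OF f k(1)] r k h par_sym by (metis comp_apply)
      finally show ?thesis .
    qed
    then have "f (g a) = h (g a)" using transl_par[OF g] par_sym by metis
    also have "\<dots> = g (f a)" using transl_commute_distinct[OF h(1) g] q h by (metis comp_apply)
    finally show ?thesis by simp
  qed
qed

lemma transl_commute: "transl p f \<Longrightarrow> transl q g \<Longrightarrow> f \<circ> g = g \<circ> f"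
  using transl_commute_distinct transl_commute_same transl_cong par_sym by metis

section \<open>The group of elations\<close>

inductive_set elation :: "('p \<Rightarrow> 'p) set" where
  elation_id: "id \<in> elation"
| elation_step: "f \<in> elation \<Longrightarrow> transl p t \<Longrightarrow> t \<circ> f \<in> elation"

lemma transl_elation: "transl p t \<Longrightarrow> t \<in> elation"
  using elation_step[OF elation_id] by fastforce

lemma elation_par: "f \<in> elation \<Longrightarrow> par (f z) z"
proof (induction rule: elation.induct)
  case (elation_step f p t)
  then show ?case using par_trans[OF transl_par[OF elation_step(2), of "f z"] elation_step(3)] by simp
qed simp

lemma elation_bij: "f \<in> elation \<Longrightarrow> bij f"
proof (induction rule: elation.induct)
  case (elation_step f p t)
  show ?case by (rule bij_comp[OF elation_step(3) transl_bij[OF elation_step(2)]])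
qed (rule bij_id)

lemma elation_circle: "f \<in> elation \<Longrightarrow> K \<in> C \<Longrightarrow> f ` K \<in> C"
proof (induction rule: elation.induct)
  case (elation_step f p t)
  then show ?case using transl_circle[OF elation_step(2), of "f ` K"] by (simp add: image_image o_def)
qed simp

lemma elation_transl_commute: "f \<in> elation \<Longrightarrow> transl p t \<Longrightarrow> f (t z) = t (f z)"
proof (induction rule: elation.induct)
  case (elation_step f q s)
  have "s (t (f z)) = t (s (f z))"
    using transl_commute[OF elation_step(2,4)] by (metis comp_apply)
  then show ?case using elation_step by simp
qed simp

lemma elation_comp: "f \<in> elation \<Longrightarrow> g \<in> elation \<Longrightarrow> f \<circ> g \<in> elation"
proof (induction rule: elation.induct)
  case (elation_step f p t)
  then show ?case using elation.elation_step[of "f \<circ> g" p t] by (simp add: o_def)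
qed simp

lemma elation_commute: "f \<in> elation \<Longrightarrow> g \<in> elation \<Longrightarrow> f (g z) = g (f z)"
proof (induction arbitrary: z rule: elation.induct)
  case (elation_step f p t)
  have "t (f (g z)) = t (g (f z))" using elation_step by simp
  also have "\<dots> = g (t (f z))" using elation_transl_commute[OF elation_step(4,2)] by simp
  finally show ?case by simp
qed simp

lemma elation_inverse: "f \<in> elation \<Longrightarrow> \<exists>g\<in>elation. g \<circ> f = id"
proof (induction rule: elation.induct)
  case elation_id
  then show ?case using elation.elation_id by (intro bexI[of _ id]) auto
next
  case (elation_step f p t)
  then obtain g where g: "g \<in> elation" "g \<circ> f = id" by blast
  have "inv_into UNIV t \<circ> t = id" using transl_bij[OF elation_step(2)] by (simp add: bij_is_inj)
  then have "(g \<circ> inv_into UNIV t) \<circ> (t \<circ> f) = id" using g(2) by (metis comp_assoc comp_id)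
  then show ?case
    using elation_comp[OF g(1) transl_elation[OF transl_inv[OF elation_step(2)]]] by blast
qed

text \<open>One translation carries a circle to any circle tangent to it, and by (C) two distinct
  circles have a common tangent circle \<open>M\<close>.\<close>

lemma elation_transitive:
  assumes "K \<in> C" "L \<in> C" shows "\<exists>f\<in>elation. f ` K = L"
proof -
  have tangent: "\<exists>f\<in>elation. f ` K = L" if K: "K \<in> C" and L: "L \<in> C" and KL: "tangent_at x K L" for K L x
  proof -
    obtain a0 where "\<not> par a0 x" using third_generator by blast
    then have a: "\<not> par (proj K a0) x" using proj(2)[OF K, of a0] par_trans par_sym by meson
    define a where "a = proj K a0"
    have aK: "a \<in> K" "\<not> par a x" using a proj(1)[OF K] by (simp_all add: a_def)
    obtain f where f: "transl x f" "f a = proj L a"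
      using transl_ex[OF aK(2) par_sym[OF proj(2)[OF L, of a]]] by blast
    have "proj K x = x" using proj_self[OF K tangent_atD(1)[OF KL]] .
    then have fK: "tangent_at x K (f ` K)" using transl_tangent[OF f(1) K] by simp
    have "f a \<noteq> x" using transl_par[OF f(1), of a] aK(2) par_sym by metis
    moreover have "f a \<in> L" using f(2) proj(1)[OF L] by simp
    ultimately have "f ` K = L"
      using tangent_unique[OF K transl_circle[OF f(1) K] L fK KL _ _ \<open>f a \<noteq> x\<close>] aK(1) by simp
    then show ?thesis using transl_elation[OF f(1)] by blast
  qed
  show ?thesis
  proof (cases "K \<subseteq> L")
    case True
    have "K = L"
    proof
      show "L \<subseteq> K"
      proof
        fix z assume z: "z \<in> L"
        have "proj K z \<in> L" using True proj(1)[OF assms(1)] by blast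
        then show "z \<in> K"
          using par_on_circle[OF assms(2) _ z proj(2)[OF assms(1)]] proj(1)[OF assms(1), of z] by simp
      qed
    qed (rule True)
    then show ?thesis using elation_id by (intro bexI[of _ id]) auto
  next
    case False
    then obtain x where x: "x \<in> K" "x \<notin> L" by blast
    obtain M y where M: "M \<in> C" "tangent_at x K M" "M \<inter> L = {y}" using axiom_C_ex[OF assms x] by blast
    obtain f where f: "f \<in> elation" "f ` K = M" using tangent[OF assms(1) M(1,2)] by blast
    obtain g where g: "g \<in> elation" "g ` M = L" using tangent[OF M(1) assms(2) tangent_atI[OF M(3)]] by blast
    have "(g \<circ> f) ` K = L" using f g by (metis image_comp)
    then show ?thesis using elation_comp[OF g(1) f(1)] by blast
  qed
qed

text \<open>In an abelian group that is transitive on the circles, the image of one circle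
  determines the element.\<close>

lemma elation_eq:
  assumes f: "f \<in> elation" and g: "g \<in> elation" and K: "K \<in> C" and fg: "f ` K = g ` K"
  shows "f = g"
proof (rule same_on_circles)
  fix L assume L: "L \<in> C"
  obtain k where k: "k \<in> elation" "k ` K = L" using elation_transitive[OF K L] by blast
  have "f ` L = k ` f ` K" "g ` L = k ` g ` K"
    using elation_commute[OF f k(1)] elation_commute[OF g k(1)] k(2) by (auto simp: image_image)
  then show "f ` L = g ` L" using fg by simp
qed (use elation_circle[OF f] elation_par f g in auto)

text \<open>\<open>tangency_group\<close> works in a type of class \<open>ab_group_add\<close>,
  whereas \<open>elation\<close> is a set of functions. So the group is presented by the free
  abelian group on all functions, those outside \<open>elation\<close> being sent to
  \<open>id\<close>.\<close>

lemma elation_presentation: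
  "\<exists>h :: (('p \<Rightarrow> 'p) \<Rightarrow>\<^sub>0 int) \<Rightarrow> 'p \<Rightarrow> 'p. (\<forall>a b. h (a + b) = h a \<circ> h b) \<and> (\<forall>a. h a \<in> elation) \<and>
     (\<forall>f\<in>elation. \<exists>a. h a = f)"
proof -
  let ?G = "\<lparr>carrier = elation, monoid.mult = (\<circ>), one = id\<rparr>"
  interpret G: comm_group ?G
  proof (rule comm_groupI)
    show "\<exists>y\<in>carrier ?G. y \<otimes>\<^bsub>?G\<^esub> x = \<one>\<^bsub>?G\<^esub>" if "x \<in> carrier ?G" for x
      using elation_inverse that by simp
    show "x \<otimes>\<^bsub>?G\<^esub> y = y \<otimes>\<^bsub>?G\<^esub> x" if "x \<in> carrier ?G" "y \<in> carrier ?G" for x y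
      using elation_commute that by auto
  qed (auto simp: elation_comp elation_id comp_assoc)
  let ?f = "\<lambda>f. if f \<in> elation then f else id"
  have "?f ` UNIV \<subseteq> carrier ?G" using elation_id by auto
  then obtain h where h: "h \<in> hom (free_Abelian_group UNIV) ?G" "\<And>x. x \<in> UNIV \<Longrightarrow> h (frag_of x) = ?f x"
    using G.free_Abelian_group_universal by blast
  have "h (a + b) = h a \<circ> h b" for a b using hom_mult[OF h(1), of a b] by simp
  moreover have "h a \<in> elation" for a using hom_carrier[OF h(1)] by auto
  moreover have "\<exists>a. h a = f" if "f \<in> elation" for f using h(2)[of f] that by auto
  ultimately show ?thesis by blast
qed

end

section \<open>Circles as group elements relative to a base circle\<close>

locale elation_action = laguerre_CS C par
  for C :: "'p set set" and par :: "'p \<Rightarrow> 'p \<Rightarrow> bool" +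
  fixes h :: "'e::ab_group_add \<Rightarrow> 'p \<Rightarrow> 'p" and B :: "'p set"
  assumes h_add: "h (a + b) z = h a (h b z)" and h_elation: "h a \<in> elation"
    and h_surj: "f \<in> elation \<Longrightarrow> \<exists>a. h a = f" and base: "B \<in> C"
begin

definition Stab :: "'p \<Rightarrow> 'e set" where "Stab x = {a. h a x = x}"
definition Trans :: "'p \<Rightarrow> 'e set" where "Trans x = {a. transl x (h a)}"
definition Ker :: "'e set" where "Ker = {a. h a = id}"

lemma h_par: "par (h a z) z"
  using elation_par[OF h_elation] .

lemma h_inj: "h a y = h a z \<Longrightarrow> y = z"
  using elation_bij[OF h_elation] by (metis bij_is_inj injD)

lemma h_circle: "K \<in> C \<Longrightarrow> h a ` K \<in> C"
  using elation_circle[OF h_elation] .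

lemma h_zero: "h 0 = id"
proof
  fix z show "h 0 z = id z" using h_add[of 0 0 z] h_inj[of 0 "h 0 z" z] by simp
qed

lemma h_commute: "h a (h b z) = h b (h a z)"
  using elation_commute[OF h_elation h_elation] .

lemma h_diff: "h (a - b) (h b z) = h a z"
  using h_add[of "a - b" b z] by simp

lemma h_uminus: "h (- a) = inv_into UNIV (h a)"
proof
  fix z
  have "h a (h (- a) z) = z" using h_add[of a "- a" z] h_zero by simp
  then show "h (- a) z = inv_into UNIV (h a) z"
    using elation_bij[OF h_elation] by (metis bij_is_inj inv_f_f)
qed

lemma diff_Stab_iff: "a - b \<in> Stab x \<longleftrightarrow> h a x = h b x"
proof -
  have "h a x = h b (h (a - b) x)" using h_diff h_commute by metis
  then show ?thesis using h_inj[of b] by (auto simp: Stab_def)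
qed

lemma diff_Ker_iff: "a - b \<in> Ker \<longleftrightarrow> h a = h b"
proof -
  have "a - b \<in> Ker \<longleftrightarrow> (\<forall>x. a - b \<in> Stab x)" by (auto simp: Ker_def Stab_def)
  then show ?thesis by (auto simp: diff_Stab_iff)
qed

lemma h_eq: "h a ` B = h b ` B \<Longrightarrow> h a = h b"
  using elation_eq[OF h_elation h_elation base] .

lemma h_onto: "K \<in> C \<Longrightarrow> \<exists>a. h a ` B = K"
  using elation_transitive[OF base] h_surj by metis

lemma h_meet: "x \<in> B \<Longrightarrow> h a x \<in> h b ` B \<longleftrightarrow> h a x = h b x"
proof
  assume x: "x \<in> B" and "h a x \<in> h b ` B"
  then obtain y where y: "y \<in> B" "h a x = h b y" by blast
  then have "par x y" using h_par[of a x] h_par[of b y] par_trans par_sym by metis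
  then show "h a x = h b x" using par_on_circle[OF base x y(1)] y(2) by simp
qed simp

lemma Stab_iff: "x \<in> B \<Longrightarrow> a \<in> Stab x \<longleftrightarrow> x \<in> h a ` B"
  using h_meet[of x 0 a] h_zero by (auto simp: Stab_def)

lemma not_par: "x \<in> B \<Longrightarrow> y \<in> B \<Longrightarrow> x \<noteq> y \<Longrightarrow> \<not> par x y"
  using par_on_circle[OF base] by blast

text \<open>For the converse, the translation along \<open>x\<close> that agrees at one further
  point \<open>y\<close> carries the first circle to the second, and regularity on circles
  identifies it with \<open>h (a - b)\<close>.\<close>

lemma diff_Trans_iff:
  assumes x: "x \<in> B"
  shows "a - b \<in> Trans x \<longleftrightarrow> tangent_at (h b x) (h b ` B) (h a ` B)"
proof -
  let ?M = "h b ` B" and ?L = "h a ` B"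
  have M: "?M \<in> C" and L: "?L \<in> C" using h_circle[OF base] by simp_all
  have pr: "proj ?M x = h b x" using proj_eq[OF M _ h_par] x by simp
  have im: "h (a - b) ` ?M = ?L" using h_diff by (simp add: image_image)
  show ?thesis
  proof
    assume "a - b \<in> Trans x"
    then have "tangent_at (proj ?M x) ?M (h (a - b) ` ?M)" using transl_tangent[OF _ M] by (simp add: Trans_def)
    then show "tangent_at (h b x) ?M ?L" using pr im by simp
  next
    assume tan: "tangent_at (h b x) ?M ?L"
    obtain y0 where y0: "\<not> par y0 x" using third_generator by blast
    define y where "y = proj ?M y0"
    have y: "y \<in> ?M" "\<not> par y x"
      using proj[OF M, of y0] y0 par_trans par_sym unfolding y_def by metis+
    obtain f where f: "transl x f" "f y = proj ?L y"
      using transl_ex[OF y(2) par_sym[OF proj(2)[OF L, of y]]] by blast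
    have fM: "f ` ?M \<in> C" "tangent_at (h b x) ?M (f ` ?M)"
      using transl_circle[OF f(1) M] transl_tangent[OF f(1) M] pr by simp_all
    have "f y \<noteq> h b x" using transl_par[OF f(1), of y] y(2) h_par[of b x] par_trans par_sym by metis
    moreover have "f y \<in> ?L" using f(2) proj(1)[OF L] by simp
    moreover have "f y \<in> f ` ?M" using y(1) by (rule imageI)
    ultimately have "f ` ?M = ?L" using tangent_unique[OF M fM(1) L fM(2) tan] by blast
    then have "f = h (a - b)" using elation_eq[OF transl_elation[OF f(1)] h_elation M] im by simp
    then show "a - b \<in> Trans x" using f(1) by (simp add: Trans_def)
  qed
qed

lemma Trans_iff: "x \<in> B \<Longrightarrow> a \<in> Trans x \<longleftrightarrow> tangent_at x B (h a ` B)"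
  using diff_Trans_iff[of x a 0] h_zero by simp

lemma Trans_Stab: "a \<in> Trans x \<Longrightarrow> a \<in> Stab x"
  using transl_fixes[of x "h a" x] by (simp add: Trans_def Stab_def)

text \<open>The splittings come from the existence of circles and translations,
  \<open>TT_split\<close> and \<open>TT_unique\<close> from (C), and \<open>match\<close> from
  \<open>matched_pencils\<close>.\<close>

sublocale tangency_group B Stab Trans Ker
proof
  fix x assume x: "x \<in> B"
  show "0 \<in> Stab x" by (simp add: Stab_def h_zero)
  show "a - b \<in> Stab x" if "a \<in> Stab x" "b \<in> Stab x" for a b
    using that by (simp add: diff_Stab_iff) (simp add: Stab_def)
  show "a - b \<in> Trans x" if "a \<in> Trans x" "b \<in> Trans x" for a b
  proof -
    have "transl x (h a \<circ> h (- b))"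
      using that transl_comp transl_inv by (auto simp: Trans_def h_uminus)
    moreover have "h a \<circ> h (- b) = h (a - b)" using h_add[of a "- b"] by auto
    ultimately show ?thesis by (simp add: Trans_def)
  qed
  show "a \<in> Trans x" if "a \<in> Ker" for a using that transl_id by (simp add: Ker_def Trans_def)
  show "a \<in> Stab x" if "a \<in> Trans x" for a using Trans_Stab that .
  show "\<exists>y\<in>B. y \<noteq> x \<and> e \<in> Stab y" if e: "e \<in> Stab x" "e \<notin> Trans x" for e
  proof -
    have "x \<in> h e ` B" using Stab_iff[OF x] e by blast
    moreover have "\<not> tangent_at x B (h e ` B)" using Trans_iff[OF x] e by blast
    ultimately have "B \<inter> h e ` B \<noteq> {x}" by (auto simp: tangent_at_def)
    then obtain y where "y \<in> B" "y \<noteq> x" "y \<in> h e ` B" using x \<open>x \<in> h e ` B\<close> by blast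
    then show ?thesis using Stab_iff by blast
  qed
  show "\<exists>t\<in>Trans x. \<exists>y\<in>B. e - t \<in> Trans y" if e: "e \<notin> Stab x" for e
  proof -
    have xe: "x \<notin> h e ` B" using Stab_iff[OF x] e by simp
    obtain M m where M: "M \<in> C" "tangent_at x B M" "M \<inter> h e ` B = {m}"
      using axiom_C_ex[OF base h_circle[OF base] x xe] by auto
    obtain t where t: "h t ` B = M" using h_onto[OF M(1)] by blast
    have "m \<in> h t ` B" using t M(3) by auto
    then obtain y where y: "y \<in> B" "h t y = m" by auto
    have "e - t \<in> Trans y" using diff_Trans_iff[OF y(1), of e t] tangent_atI[OF M(3)] t y(2) by simp
    moreover have "t \<in> Trans x" using Trans_iff[OF x] M(2) t by simp
    ultimately show ?thesis using y by blast
  qed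
  fix y assume y: "y \<in> B"
  show "t - t' \<in> Ker" if z: "z \<in> B" and e: "e \<notin> Stab x" and t: "t \<in> Trans x" "e - t \<in> Trans y"
    and t': "t' \<in> Trans x" "e - t' \<in> Trans z" for e t t' z
  proof -
    let ?L = "h e ` B"
    have xL: "x \<notin> ?L" using Stab_iff[OF x] e by blast
    have *: "tangent_at x B (h s ` B) \<and> (\<exists>m. h s ` B \<inter> ?L = {m})"
      if y: "y \<in> B" and s: "s \<in> Trans x" "e - s \<in> Trans y" for s y
    proof -
      have 1: "tangent_at x B (h s ` B)" using Trans_iff[OF x] s(1) by blast
      have 2: "tangent_at (h s y) (h s ` B) ?L" using diff_Trans_iff[OF y] s(2) by blast
      have "h s ` B \<noteq> ?L" using tangent_atD(2)[OF 1] xL by auto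
      then show ?thesis using 1 tangent_at_cases[OF 2] by auto
    qed
    obtain m m' where m: "h t ` B \<inter> ?L = {m}" "h t' ` B \<inter> ?L = {m'}" using *[OF y t] *[OF z t'] by auto
    have "h t ` B = h t' ` B"
      by (rule axiom_C_unique[OF base h_circle[OF base] x xL h_circle[OF base] _ m(1) h_circle[OF base] _ m(2)])
        (simp_all add: *[OF y t] *[OF z t'])
    then show ?thesis using h_eq diff_Ker_iff by blast
  qed
  show "d' - e' \<in> Trans r'"
    if r: "r \<in> B" and r': "r' \<in> B" and ne: "x \<noteq> y" "r \<noteq> x" "r \<noteq> y" "r' \<noteq> x" "r' \<noteq> y"
      and d: "d \<in> Stab x" "d \<in> Stab r" "d' \<in> Stab x" "d' \<in> Stab r'" "d - d' \<in> Trans x"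
      and e: "e \<in> Stab y" "e \<in> Stab r" "e' \<in> Stab y" "e' \<in> Stab r'" "e - e' \<in> Trans y"
      and de: "d - e \<in> Trans r" "d \<notin> Ker" for r r' d d' e e'
  proof -
    have dO: "h d ` B \<noteq> B" using h_eq[of d 0] h_zero de(2) by (auto simp: Ker_def)
    have fix': "h d' x = x" "h e' y = y" "h e r = r" "h e' r' = r'" using d e by (simp_all add: Stab_def)
    have 1: "tangent_at x (h d ` B) (h d' ` B)"
      using tangent_at_sym diff_Trans_iff[OF x] d(5) fix'(1) by metis
    have 2: "tangent_at y (h e ` B) (h e' ` B)"
      using tangent_at_sym diff_Trans_iff[OF y] e(5) fix'(2) by metis
    have 3: "tangent_at r (h d ` B) (h e ` B)"
      using tangent_at_sym diff_Trans_iff[OF r] de(1) fix'(3) by metis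
    have mem: "r \<in> h d ` B" "r' \<in> h d' ` B" "r \<in> h e ` B" "r' \<in> h e' ` B"
      using Stab_iff[OF r] Stab_iff[OF r'] d e by simp_all
    have "tangent_at r' (h d' ` B) (h e' ` B)"
      by (rule matched_pencils[OF base x y r r' ne h_circle[OF base] mem(1) h_circle[OF base] mem(2) 1
        h_circle[OF base] mem(3) h_circle[OF base] mem(4) 2 3 dO])
    then show ?thesis using tangent_at_sym diff_Trans_iff[OF r'] fix'(4) by metis
  qed
  assume xy: "x \<noteq> y"
  show "a \<in> Ker" if "a \<in> Trans x" "a \<in> Stab y" for a
    using transl_unique[OF _ transl_id, of x "h a" y] not_par[OF y x] xy that
    by (auto simp: Trans_def Stab_def Ker_def)
  show "\<exists>t\<in>Trans x. e - t \<in> Stab y" for e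
  proof -
    obtain f where f: "transl x f" "f y = h e y"
      using transl_ex[OF not_par[OF y x] par_sym[OF h_par[of e y]]] xy by blast
    obtain t where t: "h t = f" using h_surj[OF transl_elation[OF f(1)]] by blast
    have "t \<in> Trans x" using t f by (simp add: Trans_def)
    moreover have "e - t \<in> Stab y" using t f by (simp add: diff_Stab_iff)
    ultimately show ?thesis by blast
  qed
  fix z assume z: "z \<in> B" and xz: "x \<noteq> z" and yz: "y \<noteq> z"
  show "a \<in> Ker" if a: "a \<in> Stab x" "a \<in> Stab y" "a \<in> Stab z" for a
  proof -
    have mem: "x \<in> h a ` B" "y \<in> h a ` B" "z \<in> h a ` B"
      using Stab_iff[OF x] Stab_iff[OF y] Stab_iff[OF z] a by simp_all
    have "h a ` B = B" by (rule circle_eq[OF h_circle[OF base] base mem x y z xy yz xz])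
    then have "h a = h 0" using h_eq[of a 0] h_zero by simp
    then show ?thesis by (simp add: Ker_def h_zero)
  qed
  show "\<exists>w. w \<in> Stab x \<and> w \<in> Stab y \<and> e - w \<in> Stab z" for e
  proof -
    have "\<not> par y (h e z)" "\<not> par x (h e z)"
      using not_par[OF y z yz] not_par[OF x z xz] par_trans[OF _ h_par] by metis+
    then obtain L where L: "L \<in> C" "x \<in> L" "y \<in> L" "h e z \<in> L"
      using circle_ex[OF not_par[OF x y xy]] by auto
    obtain w where w: "h w ` B = L" using h_onto[OF L(1)] by blast
    have "w \<in> Stab x" "w \<in> Stab y" using Stab_iff[OF x] Stab_iff[OF y] w L by simp_all
    moreover have "e - w \<in> Stab z" using h_meet[OF z, of e w] w L(4) by (simp add: diff_Stab_iff)
    ultimately show ?thesis by blast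
  qed
next
  show "a - b \<in> Ker" if "a \<in> Ker" "b \<in> Ker" for a b
    using that by (simp add: diff_Ker_iff) (simp add: Ker_def)
  show "0 \<in> Ker" by (simp add: Ker_def h_zero)
  show "\<exists>r\<in>B. r \<noteq> x \<and> r \<noteq> y" for x y
  proof -
    obtain r where r: "\<not> par r x" "\<not> par r y" using third_generator by blast
    then have "proj B r \<noteq> x" "proj B r \<noteq> y" using proj(2)[OF base, of r] par_sym by metis+
    then show ?thesis using proj(1)[OF base] by blast
  qed
qed

end

section \<open>Laguerre symmetries\<close>

context elation_action begin

text \<open>In the decomposition \<open>dec\<close>, the parts \<open>a\<close> and \<open>b\<close>
  are kept and \<open>v\<close> becomes \<open>w - v\<close>, while \<open>\<pi>\<close> permutes
  the points of \<open>B\<close>. The circle \<open>B\<close> has \<open>v = 0\<close> and so goes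
  to the circle of \<open>w\<close>.\<close>

lemma exists_reflection:
  assumes p: "p \<in> B" and q: "q \<in> B" and pq: "p \<noteq> q"
    and w: "w \<in> Stab p" "w \<in> Stab q" "w \<notin> Ker"
  shows "\<exists>\<sigma>. (\<forall>z. \<sigma> (\<sigma> z) = z) \<and> (\<forall>K\<in>C. \<sigma> ` K \<in> C) \<and> (\<forall>z. par z p \<or> par z q \<longrightarrow> \<sigma> z = z) \<and>
    \<sigma> ` B = h w ` B \<and> (\<exists>M\<in>C. \<sigma> ` M = M \<and> (\<exists>x\<in>M. \<sigma> x \<noteq> x))"
proof -
  define refl where "refl x x' \<longleftrightarrow> x' \<in> B \<and> x' \<noteq> p \<and> x' \<noteq> q \<and> x' \<noteq> x \<and>
    (\<forall>a\<in>Trans p. \<forall>b\<in>Trans q. \<forall>v\<in>Stab p \<inter> Stab q. a + b + v \<in> Stab x \<longrightarrow> a + b - v \<in> Stab x')" for x x'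
  have "\<exists>x'. refl x x'" if "x \<in> B" "x \<noteq> p" "x \<noteq> q" for x
    using exists_reflected_index[OF p q that(1) pq that(2,3) w] unfolding refl_def by auto
  then obtain r where r: "\<And>x. x \<in> B \<Longrightarrow> x \<noteq> p \<Longrightarrow> x \<noteq> q \<Longrightarrow> refl x (r x)" by metis
  define \<pi> where "\<pi> x = (if x = p \<or> x = q then x else r x)" for x
  have \<pi>B: "\<pi> x \<in> B" if "x \<in> B" for x using r[OF that] that by (auto simp: \<pi>_def refl_def)
  have \<pi>ne: "\<pi> x \<noteq> p" "\<pi> x \<noteq> q" "\<pi> x \<noteq> x" if "x \<in> B" "x \<noteq> p" "x \<noteq> q" for x
    using r[OF that] that by (auto simp: \<pi>_def refl_def)
  have \<pi>S: "a + b - v \<in> Stab (\<pi> x)"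
    if "x \<in> B" "a \<in> Trans p" "b \<in> Trans q" "v \<in> Stab p" "v \<in> Stab q" "a + b + v \<in> Stab x" for a b v x
  proof (cases "x = p \<or> x = q")
    case True
    then have "v \<in> Stab x" using that by auto
    then have "(a + b + v) - (v + v) \<in> Stab x" using S_diff[OF that(1,6) S_add[OF that(1)]] by blast
    then show ?thesis using True by (simp add: \<pi>_def algebra_simps)
  next
    case False
    then show ?thesis using r[OF that(1)] that by (simp add: \<pi>_def refl_def)
  qed
  \<comment> \<open>\<open>w - c\<close> vanishes at \<open>p\<close> and \<open>x\<close> and,
    after two reflections, at \<open>\<pi> (\<pi> x)\<close>; three distinct zeros would put it into
    \<open>Ker\<close>.\<close>
  have \<pi>\<pi>: "\<pi> (\<pi> x) = x" if x: "x \<in> B" for x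
  proof (cases "x = p \<or> x = q")
    case True
    then show ?thesis by (simp add: \<pi>_def)
  next
    case False
    then have ne: "x \<noteq> p" "x \<noteq> q" by simp_all
    obtain c where c: "c \<in> Trans p" "w - c \<in> Stab x" using TS_split[OF p x, of w] ne by auto
    let ?a = "- c"
    have a: "?a \<in> Trans p" using T_uminus[OF p c(1)] .
    have "?a + 0 + w \<in> Stab x" using c(2) by simp
    then have "?a + 0 - w \<in> Stab (\<pi> x)" using \<pi>S[OF x a T_zero[OF q] w(1,2)] by simp
    then have 1: "?a + 0 - - w \<in> Stab (\<pi> (\<pi> x))"
      using \<pi>S[OF \<pi>B[OF x] a T_zero[OF q] S_uminus[OF p w(1)] S_uminus[OF q w(2)]] by simp
    show ?thesis
    proof (rule ccontr)
      assume ne2: "\<pi> (\<pi> x) \<noteq> x"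
      have 2: "w - c \<in> Stab (\<pi> (\<pi> x))" using 1 by simp
      have "w - c \<in> Stab p" using S_diff[OF p w(1) T_S[OF p c(1)]] .
      then have wc: "w - c \<in> Ker"
        using SSS_N[OF p x \<pi>B[OF \<pi>B[OF x]] _ _ _ _ c(2) 2] ne ne2 \<pi>ne(1)[OF \<pi>B[OF x] \<pi>ne(1,2)[OF x ne]] by metis
      then have "w - (w - c) \<in> Stab q" using S_diff[OF q w(2) N_S[OF q]] by blast
      then have "c \<in> Ker" using TS_N[OF p q pq c(1)] by simp
      then have "(w - c) + c \<in> Ker" using N_add[OF wc] by blast
      then show False using w(3) by simp
    qed
  qed
  have dec: "\<exists>a\<in>Trans p. \<exists>b\<in>Trans q. \<exists>v. v \<in> Stab p \<and> v \<in> Stab q \<and> e = a + b + v" for e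
  proof -
    obtain a where a: "a \<in> Trans p" "e - a \<in> Stab q" using TS_split[OF p q pq] by blast
    obtain b where b: "b \<in> Trans q" "e - a - b \<in> Stab p" using TS_split[OF q p] pq by blast
    have "e - a - b \<in> Stab q" using S_diff[OF q a(2) T_S[OF q b(1)]] .
    moreover have "e = a + b + (e - a - b)" by (simp add: algebra_simps)
    ultimately show ?thesis using a(1) b by blast
  qed
  \<comment> \<open>A point has many representations \<open>h (a + b + v) x\<close>, so the map
    starts as a relation. It is single-valued because \<open>\<pi>S\<close> turns a relation at
    \<open>x\<close> into the negated one at \<open>\<pi> x\<close>.\<close>
  define rel where "rel z z' \<longleftrightarrow> (\<exists>a b v x. a \<in> Trans p \<and> b \<in> Trans q \<and> v \<in> Stab p \<and> v \<in> Stab q \<and> x \<in> B \<and>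
    z = h (a + b + v) x \<and> z' = h (a + b + (w - v)) (\<pi> x))" for z z'
  have total: "\<exists>a b v x. a \<in> Trans p \<and> b \<in> Trans q \<and> v \<in> Stab p \<and> v \<in> Stab q \<and> x \<in> B \<and> z = h (a + b + v) x" for z
  proof -
    obtain K where K: "K \<in> C" "z \<in> K" using circle_through by blast
    obtain e where "h e ` B = K" using h_onto[OF K(1)] by blast
    then obtain x where "x \<in> B" "z = h e x" using K(2) by blast
    then show ?thesis using dec[of e] by blast
  qed
  have fun_eq: "z1 = z2" if 1: "rel z z1" and 2: "rel z z2" for z z1 z2
  proof -
    obtain a b v x where 1: "a \<in> Trans p" "b \<in> Trans q" "v \<in> Stab p" "v \<in> Stab q" "x \<in> B"
      "z = h (a + b + v) x" "z1 = h (a + b + (w - v)) (\<pi> x)" using 1 unfolding rel_def by blast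
    obtain a' b' v' x' where 2: "a' \<in> Trans p" "b' \<in> Trans q" "v' \<in> Stab p" "v' \<in> Stab q" "x' \<in> B"
      "z = h (a' + b' + v') x'" "z2 = h (a' + b' + (w - v')) (\<pi> x')" using 2 unfolding rel_def by blast
    have "par x x'" using h_par[of "a + b + v" x] h_par[of "a' + b' + v'" x'] 1(6) 2(6) par_trans par_sym by metis
    then have xx: "x' = x" using par_on_circle[OF base 1(5) 2(5)] by simp
    have "(a + b + v) - (a' + b' + v') \<in> Stab x" using 1(6) 2(6) xx by (simp add: diff_Stab_iff)
    then have "(a - a') + (b - b') + (v - v') \<in> Stab x" by (simp add: algebra_simps)
    then have "(a - a') + (b - b') - (v - v') \<in> Stab (\<pi> x)"
      by (rule \<pi>S[OF 1(5) T_diff[OF p 1(1) 2(1)] T_diff[OF q 1(2) 2(2)] S_diff[OF p 1(3) 2(3)] S_diff[OF q 1(4) 2(4)]])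
    then have "(a + b + (w - v)) - (a' + b' + (w - v')) \<in> Stab (\<pi> x)" by (simp add: algebra_simps)
    then show ?thesis by (simp only: diff_Stab_iff 1(7) 2(7) xx)
  qed
  define \<sigma> where "\<sigma> z = (SOME z'. rel z z')" for z
  have \<sigma>: "\<sigma> (h (a + b + v) x) = h (a + b + (w - v)) (\<pi> x)"
    if "a \<in> Trans p" "b \<in> Trans q" "v \<in> Stab p" "v \<in> Stab q" "x \<in> B" for a b v x
  proof -
    have "rel (h (a + b + v) x) (h (a + b + (w - v)) (\<pi> x))" unfolding rel_def using that by blast
    then show ?thesis unfolding \<sigma>_def using fun_eq by (metis someI)
  qed
  have "\<sigma> (\<sigma> z) = z" for z
  proof -
    obtain a b v x where z: "a \<in> Trans p" "b \<in> Trans q" "v \<in> Stab p" "v \<in> Stab q" "x \<in> B" "z = h (a + b + v) x"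
      using total by blast
    have "\<sigma> (\<sigma> z) = h (a + b + (w - (w - v))) (\<pi> (\<pi> x))"
      using \<sigma>[OF z(1-5)] \<sigma>[OF z(1,2) S_diff[OF p w(1) z(3)] S_diff[OF q w(2) z(4)] \<pi>B[OF z(5)]] z(6) by simp
    then show ?thesis using z(5,6) \<pi>\<pi> by simp
  qed
  moreover have im: "\<sigma> ` h (a + b + v) ` B = h (a + b + (w - v)) ` B"
    if "a \<in> Trans p" "b \<in> Trans q" "v \<in> Stab p" "v \<in> Stab q" for a b v
  proof -
    have "\<pi> ` B = B"
    proof
      show "\<pi> ` B \<subseteq> B" using \<pi>B by blast
      show "B \<subseteq> \<pi> ` B" using \<pi>B \<pi>\<pi> by (metis imageI subsetI)
    qed
    then have "h (a + b + (w - v)) ` B = h (a + b + (w - v)) ` \<pi> ` B" by simp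
    also have "\<dots> = \<sigma> ` h (a + b + v) ` B" using \<sigma>[OF that] by (auto simp: image_image)
    finally show ?thesis by simp
  qed
  moreover have "\<sigma> ` K \<in> C" if K: "K \<in> C" for K
  proof -
    obtain e where e: "h e ` B = K" using h_onto[OF K] by blast
    obtain a b v where "a \<in> Trans p" "b \<in> Trans q" "v \<in> Stab p" "v \<in> Stab q" "e = a + b + v" using dec by blast
    then have "\<sigma> ` K = h (a + b + (w - v)) ` B" using im e by metis
    then show ?thesis using h_circle[OF base] by simp
  qed
  moreover have "\<sigma> z = z" if z: "par z p \<or> par z q" for z
  proof -
    obtain a b v x where z': "a \<in> Trans p" "b \<in> Trans q" "v \<in> Stab p" "v \<in> Stab q" "x \<in> B" "z = h (a + b + v) x"
      using total by blast
    have "par x z" using h_par z'(6) par_sym by blast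
    then have "par x p \<or> par x q" using z par_trans by blast
    then have x: "x = p \<or> x = q" using par_on_circle[OF base z'(5) p] par_on_circle[OF base z'(5) q] by blast
    then have "w \<in> Stab x" "v \<in> Stab x" using w z'(3,4) by auto
    then have "w - (v + v) \<in> Stab x" using S_diff[OF z'(5) _ S_add[OF z'(5)]] by blast
    then have "(a + b + (w - v)) - (a + b + v) \<in> Stab x" by (simp add: algebra_simps)
    then have "h (a + b + (w - v)) x = z" by (simp only: diff_Stab_iff z'(6))
    moreover have "\<pi> x = x" using x by (auto simp: \<pi>_def)
    ultimately show ?thesis using \<sigma>[OF z'(1-5)] z'(6) by simp
  qed
  moreover have "\<sigma> ` B = h w ` B"
    using im[OF T_zero[OF p] T_zero[OF q] S_zero[OF p] S_zero[OF q]] by (simp add: h_zero)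
  moreover have "\<exists>M\<in>C. \<sigma> ` M = M \<and> (\<exists>x\<in>M. \<sigma> x \<noteq> x)"
  proof -
    \<comment> \<open>The half \<open>n\<close> agrees with \<open>w - n\<close> modulo
      \<open>Ker\<close>, so its circle is invariant; its points are moved since
      \<open>\<pi>\<close> fixes only \<open>p\<close> and \<open>q\<close>.\<close>
    obtain n where n: "n \<in> Stab p" "n \<in> Stab q" "w - (n + n) \<in> Ker" using exists_half[OF p q pq w(1,2)] by blast
    have "(w - n) - n \<in> Ker" using n(3) by (simp add: algebra_simps)
    then have wn: "h (w - n) = h n" by (simp only: diff_Ker_iff)
    have "\<sigma> ` h n ` B = h n ` B" using im[OF T_zero[OF p] T_zero[OF q] n(1,2)] wn by simp
    moreover obtain x where x: "x \<in> B" "x \<noteq> p" "x \<noteq> q" using third by blast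
    have "\<sigma> (h n x) = h n (\<pi> x)" using \<sigma>[OF T_zero[OF p] T_zero[OF q] n(1,2) x(1)] wn by simp
    moreover have "h n (\<pi> x) \<noteq> h n x" using h_inj \<pi>ne(3)[OF x] by blast
    ultimately show ?thesis using h_circle[OF base] x(1) by (intro bexI[of _ "h n ` B"] conjI bexI[of _ "h n x"]) auto
  qed
  ultimately show ?thesis by blast
qed

end

section \<open>Uniqueness of the double tangency symmetry\<close>

context laguerre_CS begin

lemma automorphism_circle: "automorphism C f \<Longrightarrow> K \<in> C \<Longrightarrow> f ` K \<in> C"
  unfolding automorphism_def by blast

text \<open>Distinct points are parallel exactly when no circle joins them, so a map preserving
  circles preserves parallelism.\<close>

lemma automorphism_par:
  assumes f: "automorphism C f" and xy: "par x y" shows "par (f x) (f y)"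
proof (rule ccontr)
  assume "\<not> par (f x) (f y)"
  then obtain K' where K': "K' \<in> C" "f x \<in> K'" "f y \<in> K'" using circle_ex2 by blast
  obtain K where K: "K \<in> C" "K' = f ` K" using f K'(1) unfolding automorphism_def by blast
  have "inj f" using f unfolding automorphism_def by (simp add: bij_is_inj)
  then have "x \<in> K" "y \<in> K" using K' K(2) by (simp_all add: inj_image_mem_iff)
  then have "x = y" using par_on_circle[OF K(1) _ _ xy] by simp
  then show False using \<open>\<not> par (f x) (f y)\<close> by simp
qed

lemma automorphismI:
  assumes inv: "\<And>z. f (f z) = z" and circ: "\<And>K. K \<in> C \<Longrightarrow> f ` K \<in> C"
  shows "automorphism C f" "involutory f"
proof -
  have ff: "f \<circ> f = id" using inv by auto
  have "K \<in> (\<lambda>K. f ` K) ` C" if K: "K \<in> C" for K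
  proof -
    have "K = f ` f ` K" using inv by (simp add: image_image)
    then show ?thesis using circ[OF K] by blast
  qed
  then have "(\<lambda>K. f ` K) ` C = C" using circ by blast
  then show "automorphism C f" unfolding automorphism_def using o_bij[OF ff ff] by simp
  show "involutory f" unfolding involutory_def using ff .
qed

lemma xKL_eq:
  assumes "K \<in> C" "L \<in> C" "x \<in> K" "x \<notin> L" "M \<in> C" "tangent_at x K M" "M \<inter> L = {y}"
  shows "xKL C x K L = y"
proof -
  have "(THE M. M \<in> pencil C x K \<and> card (M \<inter> L) = 1) = M"
  proof (rule the_equality)
    show "M \<in> pencil C x K \<and> card (M \<inter> L) = 1" using assms by (simp add: pencil_def)
    fix M' assume M': "M' \<in> pencil C x K \<and> card (M' \<inter> L) = 1"
    then obtain y' where "M' \<inter> L = {y'}" by (auto simp: card_1_singleton_iff)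
    then show "M' = M" using axiom_C_unique[OF assms(1-4) _ _ _ assms(5-7)] M' by (simp add: pencil_def)
  qed
  then show ?thesis using assms(4,7) by (simp add: xKL_def)
qed

text \<open>(C) is applied with \<open>K\<close> and \<open>L\<close> exchanged: the circle tangent
  to \<open>L\<close> at \<open>y\<close> that touches \<open>K\<close> in \<open>x\<close> also
  defines \<open>xKL\<close> at \<open>x\<close>.\<close>

lemma xKL_onto:
  assumes K: "K \<in> C" and L: "L \<in> C" and KL: "K \<inter> L = {p, q}" "p \<noteq> q" and y: "y \<in> L"
  shows "\<exists>x\<in>K. xKL C x K L = y"
proof (cases "y \<in> K")
  case True
  then show ?thesis using y by (intro bexI[of _ y]) (simp_all add: xKL_def)
next
  case False
  obtain M x where M: "M \<in> C" "tangent_at y L M" "M \<inter> K = {x}" using axiom_C_ex[OF L K y False] by blast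
  have x: "x \<in> K" "x \<in> M" using M(3) by auto
  have "M \<noteq> L"
  proof
    assume "M = L"
    then have "{p, q} = {x}" using M(3) KL(1) by (metis Int_commute)
    then show False using KL(2) by auto
  qed
  then have MmL: "M \<inter> L = {y}" using tangent_at_cases[OF M(2)] by auto
  have "x \<notin> L" using MmL x False by auto
  moreover have "tangent_at x K M" using M(3) by (simp add: tangent_atI Int_commute)
  ultimately show ?thesis using xKL_eq[OF K L x(1) _ M(1) _ MmL] x(1) by blast
qed

text \<open>The circle \<open>N\<close> through \<open>z\<close> tangent to \<open>K\<close> at
  \<open>p\<close> meets \<open>L\<close> in a second fixed point and is therefore invariant; as
  generators are preserved, \<open>z\<close> is fixed. If \<open>z\<close> is parallel to
  \<open>p\<close>, then \<open>q\<close> takes its place.\<close>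

lemma automorphism_fixing_circles:
  assumes f: "automorphism C f" and K: "K \<in> C" and L: "L \<in> C" and KL: "K \<inter> L = {p, q}" "p \<noteq> q"
    and fix_K: "\<And>x. x \<in> K \<Longrightarrow> f x = x" and fix_L: "\<And>x. x \<in> L \<Longrightarrow> f x = x"
  shows "f z = z"
proof -
  have fz: "par (f z) z" for z
  proof -
    have "par (f z) (f (proj K z))" using automorphism_par[OF f par_sym[OF proj(2)[OF K]]] .
    then show ?thesis using fix_K[OF proj(1)[OF K]] par_trans[OF _ proj(2)[OF K]] by metis
  qed
  have inj: "inj f" using f unfolding automorphism_def by (simp add: bij_is_inj)
  have *: "f z = z" if p: "K \<inter> L = {p, q}" "p \<noteq> q" and zp: "\<not> par p z" for p q
  proof -
    have pK: "p \<in> K" "p \<in> L" using p by auto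
    obtain N where N: "N \<in> C" "z \<in> N" "tangent_at p K N" using tangent_ex[OF K pK(1) zp] by blast
    show ?thesis
    proof (cases "N = K")
      case True
      then show ?thesis using fix_K N(2) by simp
    next
      case False
      then have KN: "K \<inter> N = {p}" using tangent_at_cases[OF N(3)] by auto
      have "\<not> tangent_at p N L"
      proof
        assume "tangent_at p N L"
        then have "tangent_at p K L" using tangent_trans[OF N(1) K L tangent_at_sym[OF N(3)]] by simp
        then have "K = L \<or> K \<inter> L = {p}" by (rule tangent_at_cases)
        moreover have "K \<inter> L \<noteq> {p}" using p by auto
        moreover have "K \<noteq> L"
        proof
          assume "K = L"
          then have "K = {p, q}" using p(1) by simp
          moreover obtain r where "\<not> par r p" "\<not> par r q" using third_generator by blast
          then have "proj K r \<noteq> p" "proj K r \<noteq> q" using proj(2)[OF K, of r] par_sym by metis+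
          ultimately show False using proj(1)[OF K, of r] by simp
        qed
        ultimately show False by simp
      qed
      moreover have "p \<in> N" using tangent_atD(2)[OF N(3)] .
      ultimately have "N \<inter> L \<noteq> {p}" using pK(2) by (auto simp: tangent_at_def)
      then obtain l where l: "l \<in> N" "l \<in> L" "l \<noteq> p" using \<open>p \<in> N\<close> pK(2) by blast
      have "f ` K = K" using fix_K by simp
      then have "K \<inter> f ` N = f ` (K \<inter> N)" using image_Int[OF inj, of K N] by simp
      then have "K \<inter> f ` N = {p}" using KN fix_K[OF pK(1)] by simp
      moreover have "l \<in> f ` N" using fix_L[OF l(2)] l(1) by (metis imageI)
      ultimately have "f ` N = N"
        using tangent_unique[OF K automorphism_circle[OF f N(1)] N(1) tangent_atI N(3) _ l(1,3)] by blast
      then have "f z \<in> N" using N(2) by blast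
      then show ?thesis using par_on_circle[OF N(1) _ N(2) fz] by blast
    qed
  qed
  have "\<not> par p q" using par_on_circle[OF K, of p q] KL by auto
  then have "\<not> par p z \<or> \<not> par q z" using par_trans par_sym by blast
  then show ?thesis using *[of p q] *[of q p] KL by (metis insert_commute)
qed

text \<open>The product of two candidates fixes \<open>K\<close> pointwise, and also
  \<open>L\<close>, because \<open>xKL\<close> maps \<open>K\<close> onto \<open>L\<close>.\<close>

lemma double_tangency_symmetry_unique:
  assumes K: "K \<in> C" and L: "L \<in> C" and KL: "K \<inter> L = {p, q}" "p \<noteq> q"
    and f: "is_double_tangency_symmetry C K L f" and g: "is_double_tangency_symmetry C K L g"
  shows "f = g"
proof -
  have aut: "automorphism C f" "automorphism C g" using f g unfolding is_double_tangency_symmetry_def by simp_all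
  have inv: "f (f z) = z" "g (g z) = z" for z
    using f g unfolding is_double_tangency_symmetry_def involutory_def by (metis comp_apply id_apply)+
  have xK: "f x = xKL C x K L" "g x = xKL C x K L" if "x \<in> K" for x
    using f g that unfolding is_double_tangency_symmetry_def by simp_all
  have "f (g x) = x" if "x \<in> K" for x using xK[OF that] inv(1)[of x] by simp
  moreover have "f (g y) = y" if y: "y \<in> L" for y
  proof -
    obtain x where x: "x \<in> K" "xKL C x K L = y" using xKL_onto[OF K L KL y] by blast
    then have "f x = y" "g x = y" using xK by simp_all
    then show ?thesis using inv by metis
  qed
  moreover have "automorphism C (f \<circ> g)"
  proof -
    have "(\<lambda>K. (f \<circ> g) ` K) ` C = (\<lambda>K. f ` K) ` (\<lambda>K. g ` K) ` C" by (simp add: image_image o_def)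
    then show ?thesis using aut bij_comp[of g f] unfolding automorphism_def by simp
  qed
  ultimately have "f (g z) = z" for z using automorphism_fixing_circles[OF _ K L KL, of "f \<circ> g" z] by simp
  then show ?thesis using inv by (metis ext)
qed

end

section \<open>Rigidity of Laguerre symmetries\<close>

locale laguerre_reflection = laguerre_CS C par
  for C :: "'p set set" and par :: "'p \<Rightarrow> 'p \<Rightarrow> bool" +
  fixes \<sigma> :: "'p \<Rightarrow> 'p" and x0 y0 m :: 'p and M :: "'p set"
  assumes aut: "automorphism C \<sigma>" and invol: "involutory \<sigma>" and npar: "\<not> par x0 y0"
    and fix_x: "par z x0 \<Longrightarrow> \<sigma> z = z" and fix_y: "par z y0 \<Longrightarrow> \<sigma> z = z"
    and M: "M \<in> C" "\<sigma> ` M = M" and m: "m \<in> M" "\<sigma> m \<noteq> m"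
begin

lemma \<sigma>\<sigma>: "\<sigma> (\<sigma> z) = z"
  using invol unfolding involutory_def by (metis comp_apply id_apply)

lemma inj_\<sigma>: "inj \<sigma>"
  using \<sigma>\<sigma> by (metis injI)

lemma circle_\<sigma>: "K \<in> C \<Longrightarrow> \<sigma> ` K \<in> C"
  using automorphism_circle[OF aut] .

lemma fixed_proj: "K \<in> C \<Longrightarrow> \<sigma> (proj K x0) = proj K x0" "K \<in> C \<Longrightarrow> \<sigma> (proj K y0) = proj K y0"
  using fix_x fix_y proj(2) by simp_all

lemma proj_distinct: "K \<in> C \<Longrightarrow> proj K x0 \<noteq> proj K y0"
  using npar proj(2)[of K x0] proj(2)[of K y0] par_trans par_sym by metis

text \<open>In the derived affine plane at a fixed point, \<open>\<sigma>\<close> would otherwise be an affine map with a pointwise fixed line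
  and another fixed point.\<close>

lemma not_parallel_image:
  assumes "par z (\<sigma> z)" shows "\<sigma> z = z"
proof (rule ccontr)
  assume z: "\<sigma> z \<noteq> z"
  then have zx: "\<not> par z x0" "\<not> par z y0" using fix_x fix_y by blast+
  \<comment> \<open>\<open>c\<close> is a fixed point on a third generator: its image is parallel to
    it and lies on the invariant circle \<open>M\<close>.\<close>
  define c where "c = proj M z"
  have c: "c \<in> M" "par c z" using proj[OF M(1)] by (simp_all add: c_def)
  have "par (\<sigma> c) (\<sigma> z)" using automorphism_par[OF aut c(2)] .
  then have "par (\<sigma> c) c" using assms c(2) par_trans par_sym by metis
  moreover have "\<sigma> c \<in> M" using c(1) M(2) by blast
  ultimately have \<sigma>c: "\<sigma> c = c" using par_on_circle[OF M(1) _ c(1)] by simp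
  have cx: "\<not> par c x0" "\<not> par c y0" using zx c(2) par_trans par_sym by metis+
  \<comment> \<open>The circle \<open>L\<close> through \<open>c\<close> tangent to \<open>N\<close>
    at \<open>?u\<close> has three fixed points and is invariant; \<open>N\<close> is then recovered
    as the circle tangent to \<open>L\<close> at \<open>?u\<close> through the fixed point
    \<open>?v\<close>.\<close>
  have inv: "\<sigma> ` N = N" if N: "N \<in> C" for N
  proof -
    let ?u = "proj N x0" and ?v = "proj N y0"
    have u: "?u \<in> N" "par ?u x0" using proj[OF N] by simp_all
    have uc: "\<not> par ?u c" using u(2) cx(1) par_trans par_sym by metis
    obtain L where L: "L \<in> C" "c \<in> L" "tangent_at ?u N L" using tangent_ex[OF N u(1) uc] by blast
    have uL: "?u \<in> L" using tangent_atD(2)[OF L(3)] .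
    let ?w = "proj L y0"
    have w: "?w \<in> L" "par ?w y0" using proj[OF L(1)] by simp_all
    have ne: "?u \<noteq> c" "c \<noteq> ?w" "?u \<noteq> ?w" using uc cx(2) w(2) u(2) npar par_trans par_sym by (metis par_refl)+
    have "?u \<in> \<sigma> ` L" "c \<in> \<sigma> ` L" "?w \<in> \<sigma> ` L"
      using fixed_proj(1)[OF N] \<sigma>c fixed_proj(2)[OF L(1)] uL L(2) w(1) by (metis imageI)+
    then have \<sigma>L: "\<sigma> ` L = L" using circle_eq[OF circle_\<sigma>[OF L(1)] L(1) _ _ _ uL L(2) w(1) ne] by simp
    have v: "?v \<in> N" "?v \<noteq> ?u" using proj(1)[OF N] proj_distinct[OF N] by simp_all
    have vN: "?v \<in> \<sigma> ` N" using fixed_proj(2)[OF N] v(1) by (metis imageI)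
    have "tangent_at ?u L (\<sigma> ` N)"
    proof (cases "N = L")
      case True
      then show ?thesis using \<sigma>L tangent_at_refl[OF uL] by simp
    next
      case False
      then have "N \<inter> L = {?u}" using tangent_at_cases[OF L(3)] by simp
      then have "\<sigma> ` N \<inter> \<sigma> ` L = {?u}" using image_Int[OF inj_\<sigma>, of N L] fixed_proj(1)[OF N] by simp
      then show ?thesis using \<sigma>L by (simp add: tangent_atI Int_commute)
    qed
    then show ?thesis using tangent_unique[OF L(1) circle_\<sigma>[OF N] N _ tangent_at_sym[OF L(3)] vN v] by simp
  qed
  let ?x = "proj M x0"
  have x: "?x \<in> M" "par ?x x0" using proj[OF M(1)] by simp_all
  have "m \<noteq> ?x" using fixed_proj(1)[OF M(1)] m(2) by auto
  then have mx: "\<not> par m ?x" using par_on_circle[OF M(1) m(1) x(1)] by blast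
  \<comment> \<open>\<open>y\<close> forces a circle tangent to \<open>M\<close> at \<open>m\<close>
    to differ from \<open>M\<close>. Being invariant, it would share the second point
    \<open>\<sigma> m\<close> with \<open>M\<close>.\<close>
  obtain y where y: "par y ?x" "y \<noteq> ?x" using other_parallel by blast
  have yM: "y \<notin> M" using par_on_circle[OF M(1) _ x(1) y(1)] y(2) by blast
  have "\<not> par m y" using mx y(1) par_trans by blast
  then obtain N where N: "N \<in> C" "y \<in> N" "tangent_at m M N" using tangent_ex[OF M(1) m(1)] by blast
  have "\<sigma> m \<in> N" using inv[OF N(1)] tangent_atD(2)[OF N(3)] by blast
  moreover have "\<sigma> m \<in> M" using M(2) m(1) by blast
  ultimately have "M = N" using tangent_at_eq[OF N(3)] m(2) by blast
  then show False using yM N(2) by simp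
qed

text \<open>\<open>z\<close>, \<open>\<sigma> z\<close> and the fixed point of \<open>N\<close> on
  the generator of \<open>x0\<close> are three common points of \<open>N\<close> and its
  image.\<close>

lemma invariant_circle:
  assumes N: "N \<in> C" "z \<in> N" "\<sigma> z \<in> N" and z: "\<sigma> z \<noteq> z"
  shows "\<sigma> ` N = N"
proof -
  let ?u = "proj N x0"
  have u: "?u \<in> N" "\<sigma> ?u = ?u" using proj(1)[OF N(1)] fixed_proj(1)[OF N(1)] by simp_all
  have "?u \<in> \<sigma> ` N" "z \<in> \<sigma> ` N" "\<sigma> z \<in> \<sigma> ` N" using u N \<sigma>\<sigma> by (metis imageI)+
  moreover have "?u \<noteq> z" "?u \<noteq> \<sigma> z" using u(2) z \<sigma>\<sigma> by metis+
  ultimately show ?thesis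
    using circle_eq[OF circle_\<sigma>[OF N(1)] N(1) _ _ _ u(1) N(2,3)] z by metis
qed

lemma image_meet:
  assumes K: "K \<in> C" and ne: "\<sigma> ` K \<noteq> K"
  shows "K \<inter> \<sigma> ` K = {proj K x0, proj K y0}"
proof -
  have "proj K x0 \<in> \<sigma> ` K" "proj K y0 \<in> \<sigma> ` K"
    using fixed_proj[OF K] proj(1)[OF K] by (metis imageI)+
  then show ?thesis using circle_meet[OF K circle_\<sigma>[OF K] proj(1)[OF K] proj(1)[OF K]] proj_distinct[OF K] ne by metis
qed

text \<open>For \<open>x\<close> on \<open>K\<close> but not on its image, the circle
  \<open>N\<close> through \<open>\<sigma> x\<close> tangent to \<open>K\<close> at \<open>x\<close>
  is invariant, so it touches the image of \<open>K\<close> at \<open>\<sigma> x\<close>. It is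
  therefore the circle that defines \<open>xKL\<close>.\<close>

lemma double_tangency:
  assumes K: "K \<in> C" and ne: "\<sigma> ` K \<noteq> K"
  shows "is_double_tangency_symmetry C K (\<sigma> ` K) \<sigma>"
proof -
  let ?L = "\<sigma> ` K"
  have "\<sigma> x = xKL C x K ?L" if x: "x \<in> K" for x
  proof (cases "x \<in> ?L")
    case True
    then have "x = proj K x0 \<or> x = proj K y0" using image_meet[OF K ne] x by blast
    then have "\<sigma> x = x" using fixed_proj[OF K] by metis
    then show ?thesis using True by (simp add: xKL_def)
  next
    case False
    have \<sigma>x: "\<sigma> x \<in> ?L" using x by simp
    then have nx: "\<sigma> x \<noteq> x" using False by metis
    then have "\<not> par x (\<sigma> x)" using not_parallel_image by blast
    then obtain N where N: "N \<in> C" "\<sigma> x \<in> N" "tangent_at x K N" using tangent_ex[OF K x] by blast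
    have \<sigma>N: "\<sigma> ` N = N" using invariant_circle[OF N(1) tangent_atD(2)[OF N(3)] N(2) nx] .
    then have "K \<noteq> N" using ne by blast
    then have "K \<inter> N = {x}" using tangent_at_cases[OF N(3)] by simp
    then have "N \<inter> ?L = {\<sigma> x}" using image_Int[OF inj_\<sigma>, of K N] \<sigma>N by (simp add: Int_commute)
    then show ?thesis using xKL_eq[OF K circle_\<sigma>[OF K] x False N(1,3)] by simp
  qed
  then show ?thesis unfolding is_double_tangency_symmetry_def
    using aut invol invariant_circle by blast
qed

text \<open>A circle meeting \<open>M\<close> only in \<open>m\<close> and in the fixed point
  \<open>?x\<close> contains \<open>m\<close> but not \<open>\<sigma> m\<close>.\<close>

lemma exists_moved_circle: "\<exists>K\<in>C. \<sigma> ` K \<noteq> K"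
proof -
  let ?x = "proj M x0"
  have x: "?x \<in> M" "\<sigma> ?x = ?x" using proj(1)[OF M(1)] fixed_proj(1)[OF M(1)] by simp_all
  have mx: "m \<noteq> ?x" using x(2) m(2) by metis
  have \<sigma>m: "\<sigma> m \<in> M" "\<sigma> m \<noteq> ?x" using m M(2) x(2) mx inj_\<sigma> by (blast, metis \<sigma>\<sigma>)
  obtain r where r: "\<not> par r ?x" "\<not> par r m" using third_generator by blast
  define s where "s = proj M r"
  have s: "s \<in> M" "par s r" using proj[OF M(1)] by (simp_all add: s_def)
  obtain y where y: "par y s" "y \<noteq> s" using other_parallel by blast
  have yM: "y \<notin> M" using par_on_circle[OF M(1) _ s(1) y(1)] y(2) by blast
  have "\<not> par y ?x" "\<not> par m y" using r s(2) y(1) par_trans par_sym by metis+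
  moreover have "\<not> par m ?x" using par_on_circle[OF M(1) m(1) x(1)] mx by blast
  ultimately obtain K where K: "K \<in> C" "m \<in> K" "y \<in> K" "?x \<in> K" using circle_ex[of m y ?x] by blast
  have "M \<noteq> K" using yM K(3) by blast
  then have MK: "M \<inter> K = {m, ?x}" using circle_meet[OF M(1) K(1) m(1) x(1) K(2,4) mx] by simp
  have "\<sigma> m \<notin> K" using MK \<sigma>m m(2) by blast
  then have "\<sigma> ` K \<noteq> K" using K(2) by blast
  then show ?thesis using K(1) by blast
qed

end

lemma laguerre_symmetryE:
  assumes "laguerre_CS C par" "laguerre_symmetry C par \<sigma>"
  obtains x0 y0 m M where "laguerre_reflection C par \<sigma> x0 y0 m M"
proof -
  interpret laguerre_CS C par by (rule assms(1))
  obtain X Y M where XY: "automorphism C \<sigma>" "involutory \<sigma>" "generator par X" "generator par Y" "X \<noteq> Y" "M \<in> C"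
    "\<forall>x \<in> X \<union> Y. \<sigma> x = x" "\<sigma> ` M = M" "\<not> (\<forall>x\<in>M. \<sigma> x = x)"
    using assms(2) unfolding laguerre_symmetry_def by blast
  obtain x0 y0 where gen: "X = {y. par x0 y}" "Y = {y. par y0 y}" using XY(3,4) unfolding generator_def by blast
  obtain m where m: "m \<in> M" "\<sigma> m \<noteq> m" using XY(9) by blast
  have "\<not> par x0 y0"
  proof
    assume "par x0 y0"
    then have "par x0 z \<longleftrightarrow> par y0 z" for z using par_trans par_sym by blast
    then show False using XY(5) gen by simp
  qed
  then have "laguerre_reflection C par \<sigma> x0 y0 m M"
    by unfold_locales (use XY gen m par_sym in auto)
  then show ?thesis using that by blast
qed

section \<open>Existence of the symmetry and conclusion\<close>

context laguerre_CS begin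

text \<open>\<open>K\<close> becomes the base circle, and \<open>w\<close> is an element carrying
  \<open>K\<close> to \<open>L\<close>. The resulting reflection meets the assumptions of
  \<open>laguerre_reflection\<close>, so \<open>double_tangency\<close> applies to it.\<close>

lemma exists_symmetry:
  assumes K: "K \<in> C" and L: "L \<in> C" and KL: "K \<inter> L = {p, q}" "p \<noteq> q"
  shows "\<exists>\<sigma>. laguerre_symmetry C par \<sigma> \<and> is_double_tangency_symmetry C K L \<sigma>"
proof -
  obtain h :: "(('p \<Rightarrow> 'p) \<Rightarrow>\<^sub>0 int) \<Rightarrow> 'p \<Rightarrow> 'p" where h: "\<forall>a b. h (a + b) = h a \<circ> h b"
    "\<forall>a. h a \<in> elation" "\<forall>f\<in>elation. \<exists>a. h a = f" using elation_presentation by blast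
  interpret elation_action C par h K
    by unfold_locales (use h K in auto)
  have p: "p \<in> K" "p \<in> L" "q \<in> K" "q \<in> L" using KL by auto
  obtain w where w: "h w ` K = L" using h_onto[OF L] by blast
  have wS: "w \<in> Stab p" "w \<in> Stab q" using Stab_iff w p by simp_all
  have pqK: "K \<noteq> {p, q}" 
  proof -
    obtain r where "r \<in> K" "r \<noteq> p" "r \<noteq> q" using third by blast
    then show ?thesis by blast
  qed
  then have KneL: "K \<noteq> L" using KL by auto
  then have "w \<notin> Ker" using w by (auto simp: Ker_def)
  then obtain \<sigma> where \<sigma>: "\<And>z. \<sigma> (\<sigma> z) = z" "\<And>K. K \<in> C \<Longrightarrow> \<sigma> ` K \<in> C"
    "\<And>z. par z p \<or> par z q \<Longrightarrow> \<sigma> z = z" "\<sigma> ` K = L" "\<exists>M\<in>C. \<sigma> ` M = M \<and> (\<exists>x\<in>M. \<sigma> x \<noteq> x)"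
    using exists_reflection[OF p(1,3) KL(2) wS] w by blast
  obtain M m where Mm: "M \<in> C" "\<sigma> ` M = M" "m \<in> M" "\<sigma> m \<noteq> m" using \<sigma>(5) by blast
  have aut: "automorphism C \<sigma>" "involutory \<sigma>" using automorphismI[of \<sigma>, OF \<sigma>(1,2)] by blast+
  have npq: "\<not> par p q" using par_on_circle[OF K p(1,3)] KL(2) by blast
  interpret laguerre_reflection C par \<sigma> p q m M
    by unfold_locales (use aut npq \<sigma>(3) Mm in auto)
  have "is_double_tangency_symmetry C K L \<sigma>" using double_tangency[OF K] \<sigma>(4) KneL by simp
  moreover have "laguerre_symmetry C par \<sigma>"
  proof -
    let ?X = "{y. par p y}" and ?Y = "{y. par q y}"
    have gen: "generator par ?X" "generator par ?Y" unfolding generator_def by blast+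
    have XY: "?X \<noteq> ?Y" using npq par_refl par_sym by blast
    have fixed: "\<forall>x\<in>?X \<union> ?Y. \<sigma> x = x" using \<sigma>(3) par_sym by blast
    have moved: "\<not> (\<forall>x\<in>M. \<sigma> x = x)" using Mm(3,4) by blast
    have "\<exists>X Y M. generator par X \<and> generator par Y \<and> X \<noteq> Y \<and> M \<in> C \<and>
        (\<forall>x \<in> X \<union> Y. \<sigma> x = x) \<and> \<sigma> ` M = M \<and> \<not> (\<forall>x\<in>M. \<sigma> x = x)"
      by (rule exI[of _ ?X], rule exI[of _ ?Y], rule exI[of _ M])
        (intro conjI gen XY Mm(1,2) fixed moved)
    then show ?thesis unfolding laguerre_symmetry_def using aut invol by simp
  qed
  ultimately show ?thesis by blast
qed

lemma double_tangency_symmetry_eq: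
  assumes "K \<in> C" "L \<in> C" "K \<inter> L = {p, q}" "p \<noteq> q" "is_double_tangency_symmetry C K L f"
  shows "double_tangency_symmetry C K L = f"
  unfolding double_tangency_symmetry_def
  by (rule the_equality[where P = "is_double_tangency_symmetry C K L", OF assms(5)
      double_tangency_symmetry_unique[OF assms(1-4) _ assms(5)]])

end

theorem theorem3p2:
  fixes C :: "'p set set" and par :: "'p \<Rightarrow> 'p \<Rightarrow> bool" and \<sigma> :: "'p \<Rightarrow> 'p"
  assumes "laguerre_plane C par" and "axiom_C C" and "axiom_S C par"
    and "automorphism C \<sigma>"
  shows "laguerre_symmetry C par \<sigma> \<longleftrightarrow>
    (\<exists>K L. K \<in> C \<and> L \<in> C \<and> card (K \<inter> L) = 2 \<and> \<sigma> = double_tangency_symmetry C K L)"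
proof
  interpret laguerre_CS C par by unfold_locales (fact assms)+
  assume "laguerre_symmetry C par \<sigma>"
  then obtain x0 y0 m M where "laguerre_reflection C par \<sigma> x0 y0 m M"
    using laguerre_symmetryE laguerre_CS_axioms by blast
  then interpret laguerre_reflection C par \<sigma> x0 y0 m M .
  obtain K where K: "K \<in> C" "\<sigma> ` K \<noteq> K" using exists_moved_circle by blast
  have "double_tangency_symmetry C K (\<sigma> ` K) = \<sigma>"
    using double_tangency_symmetry_eq[OF K(1) circle_\<sigma>[OF K(1)] image_meet[OF K] proj_distinct[OF K(1)] double_tangency[OF K]] .
  moreover have "card (K \<inter> \<sigma> ` K) = 2" using image_meet[OF K] proj_distinct[OF K(1)] by simp
  ultimately have "K \<in> C \<and> \<sigma> ` K \<in> C \<and> card (K \<inter> \<sigma> ` K) = 2 \<and> \<sigma> = double_tangency_symmetry C K (\<sigma> ` K)"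
    using K(1) circle_\<sigma>[OF K(1)] by simp
  then show "\<exists>K L. K \<in> C \<and> L \<in> C \<and> card (K \<inter> L) = 2 \<and> \<sigma> = double_tangency_symmetry C K L"
    by (intro exI)
next
  interpret laguerre_CS C par by unfold_locales (fact assms)+
  assume "\<exists>K L. K \<in> C \<and> L \<in> C \<and> card (K \<inter> L) = 2 \<and> \<sigma> = double_tangency_symmetry C K L"
  then obtain K L where K: "K \<in> C" "L \<in> C" "card (K \<inter> L) = 2" "\<sigma> = double_tangency_symmetry C K L" by blast
  obtain p q where pq: "K \<inter> L = {p, q}" "p \<noteq> q" using K(3) by (auto simp: card_2_iff)
  obtain \<sigma>' where \<sigma>': "laguerre_symmetry C par \<sigma>'" "is_double_tangency_symmetry C K L \<sigma>'"
    using exists_symmetry[OF K(1,2) pq] by (elim exE conjE)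
  then show "laguerre_symmetry C par \<sigma>" using double_tangency_symmetry_eq[OF K(1,2) pq \<sigma>'(2)] K(4) by simp
qed

end
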